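(* Let $m\ge1$ and let $\phi\in C^\infty(\mathbb R^2)$ satisfy, for some $C>0$ and all $z\in\mathbb R^2$, $|D^3\phi(z)|\le C|z|^{2m-1}$, $|D^2\phi(z)|\le C|z|^{2m}$, $|D\phi(z)|\le C|z|^{2m+1}$. Then the epigraph $\mathrm{epi}(\phi)=\{(z,t)\in\mathbb R^3:t>\phi(z)\}$ is a uniform domain in $(\mathbb R^3,d)$: there exist $\varepsilon,\delta>0$ such that for every $p,q\in\mathrm{epi}(\phi)$ there is a continuous curve $\gamma:[0,1]\to\mathrm{epi}(\phi)$ with $\gamma(0)=p$, $\gamma(1)=q$, $\operatorname{diam}(\gamma)\le\delta^{-1}d(p,q)$ and $B(\gamma(t),\varepsilon\Delta_t)\subset\mathrm{epi}(\phi)$ for all $t\in[0,1]$, where $\Delta_t=\min\{\operatorname{diam}(\gamma|_{[0,t]}),\operatorname{diam}(\gamma|_{[t,1]})\}$.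
   Context: Write points of $\mathbb R^3=\mathbb C\times\mathbb R$ as $(z,t)=(x,y,t)$. For a real parameter $m\ge1$ consider the vector fields $X=\partial_x+|z|^{2m}y\,\partial_t$ and $Y=\partial_y-|z|^{2m}x\,\partial_t$. An absolutely continuous curve $\gamma:[0,1]\to\mathbb R^3$ is horizontal if $\dot\gamma(s)=\alpha(s)X(\gamma(s))+\beta(s)Y(\gamma(s))$ for a.e. $s$, with length $\int_0^1|(\alpha(s),\beta(s))|\,ds$; the Carnot–Carathéodory distance $d(p,q)$ is the infimum of lengths of horizontal curves joining $p$ to $q$, $B(p,r)=\{q:d(p,q)<r\}$, and diameters are taken with respect to $d$. $|D^k\phi(z)|$ is the maximum of the absolute values of all $k$-th order partial derivatives of $\phi$ at $z$. *)

theory Defs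
  imports "HOL-Analysis.Analysis"
begin

type_synonym pt = "real \<times> real \<times> real"

definition abs_continuous_on :: "real \<Rightarrow> real \<Rightarrow> (real \<Rightarrow> 'a::metric_space) \<Rightarrow> bool" where
  "abs_continuous_on lo hi f \<longleftrightarrow>
     (\<forall>e>0. \<exists>d>0. \<forall>(n::nat) (a::nat\<Rightarrow>real) b.
        (\<forall>i<n. lo \<le> a i \<and> a i \<le> b i \<and> b i \<le> hi) \<and>
        (\<forall>i<n. \<forall>j<n. i \<noteq> j \<longrightarrow> b i \<le> a j \<or> b j \<le> a i) \<and>
        (\<Sum>i<n. b i - a i) < d \<longrightarrow> (\<Sum>i<n. dist (f (a i)) (f (b i))) < e)"

definition Xf :: "real \<Rightarrow> pt \<Rightarrow> pt" where
  "Xf m p = (case p of (x, y, t) \<Rightarrow> (1, 0, (x\<^sup>2 + y\<^sup>2) powr m * y))"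

definition Yf :: "real \<Rightarrow> pt \<Rightarrow> pt" where
  "Yf m p = (case p of (x, y, t) \<Rightarrow> (0, 1, - ((x\<^sup>2 + y\<^sup>2) powr m * x)))"

definition horizontal_with :: "real \<Rightarrow> (real \<Rightarrow> pt) \<Rightarrow> (real \<Rightarrow> real) \<Rightarrow> (real \<Rightarrow> real) \<Rightarrow> bool" where
  "horizontal_with m \<gamma> \<alpha> \<beta> \<longleftrightarrow> abs_continuous_on 0 1 \<gamma> \<and>
     (AE s in lebesgue_on {0..1}.
        (\<gamma> has_vector_derivative (\<alpha> s *\<^sub>R Xf m (\<gamma> s) + \<beta> s *\<^sub>R Yf m (\<gamma> s))) (at s within {0..1}))"

definition ctrl_length :: "(real \<Rightarrow> real) \<Rightarrow> (real \<Rightarrow> real) \<Rightarrow> ennreal" where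
  "ctrl_length \<alpha> \<beta> = (\<integral>\<^sup>+ s. ennreal (sqrt ((\<alpha> s)\<^sup>2 + (\<beta> s)\<^sup>2)) \<partial>lebesgue_on {0..1})"

text \<open>Carnot-Caratheodory distance (infinite if no horizontal curve exists)\<close>
definition cc_dist :: "real \<Rightarrow> pt \<Rightarrow> pt \<Rightarrow> ennreal" where
  "cc_dist m p q = (INF L \<in> {ctrl_length \<alpha> \<beta> | \<gamma> \<alpha> \<beta>.
       horizontal_with m \<gamma> \<alpha> \<beta> \<and> \<gamma> 0 = p \<and> \<gamma> 1 = q}. L)"

definition cc_ball :: "real \<Rightarrow> pt \<Rightarrow> ennreal \<Rightarrow> pt set" where
  "cc_ball m p r = {q. cc_dist m p q < r}"

definition cc_diam :: "real \<Rightarrow> pt set \<Rightarrow> ennreal" where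
  "cc_diam m S = (SUP (p, q) \<in> S \<times> S. cc_dist m p q)"

definition pdx :: "(real \<times> real \<Rightarrow> real) \<Rightarrow> real \<times> real \<Rightarrow> real" where
  "pdx f z = deriv (\<lambda>u. f (u, snd z)) (fst z)"
definition pdy :: "(real \<times> real \<Rightarrow> real) \<Rightarrow> real \<times> real \<Rightarrow> real" where
  "pdy f z = deriv (\<lambda>v. f (fst z, v)) (snd z)"

fun pd :: "bool list \<Rightarrow> (real \<times> real \<Rightarrow> real) \<Rightarrow> real \<times> real \<Rightarrow> real" where
  "pd [] f = f"
| "pd (d # ds) f = (if d then pdx (pd ds f) else pdy (pd ds f))"

definition smooth2 :: "(real \<times> real \<Rightarrow> real) \<Rightarrow> bool" where
  "smooth2 f \<longleftrightarrow> (\<forall>ds. continuous_on UNIV (pd ds f) \<and>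
      (\<forall>x y. (\<lambda>u. pd ds f (u, y)) differentiable (at x) \<and>
             (\<lambda>v. pd ds f (x, v)) differentiable (at y)))"

definition Dk_norm :: "nat \<Rightarrow> (real \<times> real \<Rightarrow> real) \<Rightarrow> real \<times> real \<Rightarrow> real" where
  "Dk_norm k f z = Max {\<bar>pd ds f z\<bar> | ds. length ds = k}"

definition epi :: "(real \<times> real \<Rightarrow> real) \<Rightarrow> pt set" where
  "epi \<phi> = {(x, y, t). t > \<phi> (x, y)}"

end

(*
Use the coordinates z and f = t - phi(z), in which the epigraph is the half space f > 0. Write
om(z) = |z|^(2m) (y, -x) for the t-components of X and Y, H = om - grad phi for the horizontal
gradient of t - phi, and scale(z, r) = r^2 (|z| + r)^(2m). The bound on the second derivatives
gives |H(w) - H(z)| r <= L scale(z, r) for |w - z| <= r, and up to constants d(p, q) <= r holds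
iff |z_q - z_p| <= r and |f_q - f_p - H(z_p).(z_q - z_p)| <= scale(z_p, r).
From p run along the cone curve s |-> (z + s H/|H|, f + |H| s + scale(z, s)). At time s it is at
distance O(s) from p, and its height is at least |H| s + scale(z, s), which is also the order of
the largest change of f over a ball of radius s. With r = 2 d(p, q), follow the cone curves from
p and from q up to time r and join their ends linearly in the coordinates (z, f): the
description of balls around p is convex there, and both ends have height of order
|H| r + scale(z, r). Nothing forces the curve to be horizontal.
*)
theory Submission
  imports Defs
begin

section \<open>The fundamental theorem of calculus for absolutely continuous curves\<close>

text \<open>The two halves of the description of balls need different tools. A lower bound on
  \<open>cc_dist\<close> concerns every absolutely continuous curve with an a.e. derivative, whose
  controls are not assumed measurable; hence a fundamental theorem of calculus in the gauge
  integral. An upper bound needs one good curve, uniformly down to z = 0, where [X, Y] vanishes.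
  Radial motion leaves t unchanged, while turning by an angle A at radius R costs length R |A| and
  changes t by -R^(2m+2) A. So the curve moves out to radius |z| + 2r, turns there, and turns back
  at the final radius to correct t. The scale term of the cone curves is there because |H| s alone
  may vanish or be far smaller than the variation of the height. Conversely, |H(w) - H(z)| r <= L
  scale(z, r) makes |H| r + scale(z, r) comparable at base points at distance r, which is what
  allows the cones from p and q to be joined. The factor 2 in r = 2 d(p, q) gives the strict
  inequality d(p, q) < r, which produces an actual curve of length below r.\<close>

lemma has_integral_abs_continuous_on:
  fixes f :: "real \<Rightarrow> 'a::banach"
  assumes "a \<le> b" and ac: "abs_continuous_on a b f" and N: "negligible N"
    and deriv: "\<And>x. x \<in> {a..b} - N \<Longrightarrow> (f has_vector_derivative f' x) (at x within {a..b})"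
  shows "(f' has_integral (f b - f a)) {a..b}"
proof -
  \<comment> \<open>Nothing is known about \<open>f'\<close> on \<open>N\<close>. Replacing it by 0
    there leaves the gauge integral unchanged and makes tags in \<open>N\<close> contribute nothing
    to a Riemann sum.\<close>
  define g where "g x = (if x \<in> N then 0 else f' x)" for x
  have "(g has_integral (f b - f a)) (cbox a b)"
    unfolding has_integral
  proof safe
    fix e :: real assume "e > 0"
    define e1 where "e1 = e / (2 * (b - a + 1))"
    have "e1 > 0" using \<open>e > 0\<close> \<open>a \<le> b\<close> by (simp add: e1_def)
    have e1: "e1 * (b - a) < e / 2"
      using \<open>e > 0\<close> \<open>a \<le> b\<close> by (simp add: e1_def field_simps)
    have "\<exists>d>0. x \<in> {a..b} - N \<longrightarrow>
         (\<forall>y\<in>{a..b}. norm (y-x) < d \<longrightarrow> norm (f y - f x - (y-x) *\<^sub>R f' x) \<le> e1 * norm (y-x))" for x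
    proof (cases "x \<in> {a..b} - N")
      case True
      from deriv[OF this] show ?thesis
        unfolding has_vector_derivative_def has_derivative_within_alt using \<open>e1 > 0\<close> by blast
    qed (auto intro: exI[of _ 1])
    then have "\<forall>x. \<exists>d>0. x \<in> {a..b} - N \<longrightarrow>
         (\<forall>y\<in>{a..b}. norm (y-x) < d \<longrightarrow> norm (f y - f x - (y-x) *\<^sub>R f' x) \<le> e1 * norm (y-x))"
      by blast
    from choice[OF this] obtain d where d0: "\<forall>x. d x > 0 \<and> (x \<in> {a..b} - N \<longrightarrow>
         (\<forall>y\<in>{a..b}. norm (y-x) < d x \<longrightarrow> norm (f y - f x - (y-x) *\<^sub>R f' x) \<le> e1 * norm (y-x)))"
      by blast
    have d: "0 < d x" "\<lbrakk>x \<in> {a..b} - N; y \<in> {a..b}; norm (y-x) < d x\<rbrakk>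
        \<Longrightarrow> norm (f y - f x - (y-x) *\<^sub>R f' x) \<le> e1 * norm (y-x)" for x y
      using d0 by blast+
    obtain \<eta> where "\<eta> > 0" and \<eta>0: "\<forall>(n::nat) (u::nat\<Rightarrow>real) v. (\<forall>i<n. a \<le> u i \<and> u i \<le> v i \<and> v i \<le> b) \<and>
        (\<forall>i<n. \<forall>j<n. i \<noteq> j \<longrightarrow> v i \<le> u j \<or> v j \<le> u i) \<and>
        (\<Sum>i<n. v i - u i) < \<eta> \<longrightarrow> (\<Sum>i<n. dist (f (u i)) (f (v i))) < e / 2"
      using ac[unfolded abs_continuous_on_def, rule_format, OF half_gt_zero[OF \<open>e > 0\<close>]] by blast
    have "N \<in> lmeasurable" using N negligible_imp_measurable by blast
    then obtain U where U: "open U" "N \<subseteq> U" and UN: "U - N \<in> lmeasurable" "emeasure lebesgue (U - N) < ennreal \<eta>"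
      using sets_lebesgue_outer_open[OF fmeasurableD \<open>\<eta> > 0\<close>] by metis
    have "U = N \<union> (U - N)" using U by blast
    then have lU: "U \<in> lmeasurable" using UN \<open>N \<in> lmeasurable\<close> by (metis fmeasurable.Un)
    have "measure lebesgue U \<le> measure lebesgue N + measure lebesgue (U - N)"
      using \<open>U = N \<union> (U - N)\<close> measure_Un_le[of N lebesgue "U - N"] \<open>N \<in> lmeasurable\<close> UN by (metis fmeasurableD)
    also have "measure lebesgue N = 0" using N by (rule negligible_imp_measure0)
    also have "measure lebesgue (U - N) < \<eta>"
      using UN by (simp add: emeasure_eq_measure2 ennreal_less_iff)
    finally have mU: "measure lebesgue U < \<eta>" by simp
    \<comment> \<open>A tag outside \<open>N\<close> gets its radius of differentiability. A tag in
      \<open>N\<close> forces its interval into the open set \<open>U\<close>, whose measure is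
      below the threshold \<open>\<eta>\<close> of absolute continuity, so the increments of
      \<open>f\<close> over such intervals sum to less than e/2.\<close>
    define \<gamma> where "\<gamma> x = (if x \<in> N then U else ball x (d x))" for x
    show "\<exists>\<gamma>. gauge \<gamma> \<and> (\<forall>p. p tagged_division_of (cbox a b) \<and> \<gamma> fine p \<longrightarrow>
      norm ((\<Sum>(x, k)\<in>p. measure lborel k *\<^sub>R g x) - (f b - f a)) < e)"
    proof (rule exI[of _ \<gamma>], intro conjI allI impI, goal_cases)
      case 1
      show "gauge \<gamma>" using U d(1) by (auto simp: gauge_def \<gamma>_def)
    next
      case (2 p)
      then have ptag: "p tagged_division_of cbox a b" and finep: "\<gamma> fine p" by auto
      have fineK: "K \<subseteq> \<gamma> x" if "(x, K) \<in> p" for x K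
        using finep that by (auto simp: fine_def)
      have finp: "finite p" using ptag by blast
      have ba: "b - a = (\<Sum>(x,K)\<in>p. Sup K - Inf K)" "f b - f a = (\<Sum>(x,K)\<in>p. f(Sup K) - f(Inf K))"
        using additive_tagged_division_1[where f= "\<lambda>x. x"] additive_tagged_division_1[where f= f]
              \<open>a \<le> b\<close> ptag by auto
      have K: "\<exists>u v. K = {u..v} \<and> a \<le> u \<and> u \<le> x \<and> x \<le> v \<and> v \<le> b \<and> Inf K = u \<and> Sup K = v \<and> measure lborel K = v - u"
        if xK: "(x, K) \<in> p" for x K
      proof -
        have "x \<in> K" "K \<subseteq> cbox a b"
          using tagged_division_ofD(2,3)[OF ptag xK] by auto
        moreover obtain u v where "K = cbox u v" using tagged_division_ofD(4)[OF ptag xK] by blast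
        ultimately have "K = {u..v}" "a \<le> u" "u \<le> x" "x \<le> v" "v \<le> b" by auto
        then show ?thesis by (intro exI[of _ u] exI[of _ v]) simp
      qed
      \<comment> \<open>Degenerate intervals are dropped: they may lie inside others, which absolute continuity does not allow.\<close>
      define q where "q = {(x, K) \<in> p. x \<in> N \<and> measure lborel K \<noteq> 0}"
      have "q \<subseteq> p" by (auto simp: q_def)
      then have "finite q" using finp finite_subset by blast
      have good: "norm (measure lborel K *\<^sub>R g x - (f (Sup K) - f (Inf K))) \<le> e1 * (Sup K - Inf K)"
        if xK: "(x, K) \<in> p - q" for x K
      proof -
        obtain u v where uv: "K = {u..v}" "a \<le> u" "u \<le> x" "x \<le> v" "v \<le> b" "Inf K = u" "Sup K = v" "measure lborel K = v - u"
          using K[of x K] xK by blast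
        show ?thesis
        proof (cases "x \<in> N")
          case True
          then have "measure lborel K = 0" using that by (auto simp: q_def)
          then show ?thesis using uv by simp
        next
          case False
          have "K \<subseteq> ball x (d x)" using fineK[of x K] xK False by (auto simp: \<gamma>_def)
          then have b: "norm (u - x) < d x" "norm (v - x) < d x"
            using uv by (force simp: dist_real_def)+
          have "norm ((v - u) *\<^sub>R f' x - (f v - f u)) = norm (f u - f x - (u - x) *\<^sub>R f' x - (f v - f x - (v - x) *\<^sub>R f' x))"
            by (auto simp: algebra_simps)
          also have "\<dots> \<le> norm (f u - f x - (u - x) *\<^sub>R f' x) + norm (f v - f x - (v - x) *\<^sub>R f' x)"
            by (rule norm_triangle_ineq4)
          also have "\<dots> \<le> e1 * norm (u - x) + e1 * norm (v - x)"
            using uv b False by (intro add_mono d) auto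
          also have "\<dots> = e1 * (v - u)" using uv by (simp add: algebra_simps)
          finally show ?thesis using uv False by (simp add: g_def)
        qed
      qed
      have bad: "(\<Sum>(x,K)\<in>q. dist (f (Inf K)) (f (Sup K))) < e / 2"
      proof -
        \<comment> \<open>Absolute continuity is stated for indexed families, so the intervals of
          \<open>q\<close> are enumerated. They do not overlap and lie in \<open>U\<close>, which
          bounds their total length.\<close>
        obtain h where h: "bij_betw h {..<card q} q"
          using \<open>finite q\<close> ex_bij_betw_nat_finite lessThan_atLeast0 by metis
        define k where "k i = snd (h i)" for i
        have hq: "h i \<in> q" if "i < card q" for i
          using h that by (auto simp: bij_betw_def)
        have kK: "\<exists>x. (x, k i) \<in> q" if "i < card q" for i
          using hq[OF that] by (metis k_def prod.collapse)
        have re: "(\<Sum>(x,K)\<in>q. F (Inf K) (Sup K)) = (\<Sum>i<card q. F (Inf (k i)) (Sup (k i)))"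
          for F :: "real \<Rightarrow> real \<Rightarrow> real"
          using sum.reindex_bij_betw[OF h, of "\<lambda>(x,K). F (Inf K) (Sup K)"]
          by (simp add: k_def case_prod_beta)
        have disj: "interior (snd z) \<inter> interior (snd w) = {}" if "z \<in> q" "w \<in> q" "z \<noteq> w" for z w
          using tagged_division_ofD(5)[OF ptag, of "fst z" "snd z" "fst w" "snd w"] that \<open>q \<subseteq> p\<close> by auto
        have Kq: "\<exists>u v. snd z = {u..v} \<and> Inf (snd z) = u \<and> Sup (snd z) = v \<and> u \<le> v" if "z \<in> q" for z
        proof -
          have "(fst z, snd z) \<in> p" using that \<open>q \<subseteq> p\<close> by auto
          from K[OF this] show ?thesis by auto
        qed
        have lmq: "snd z \<in> lmeasurable" if "z \<in> q" for z
          using Kq[OF that] by (metis box_real(2) lmeasurable_cbox)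
        have "(\<Sum>(x,K)\<in>q. Sup K - Inf K) = (\<Sum>z\<in>q. measure lebesgue (snd z))"
        proof (rule sum.cong[OF refl])
          fix z assume "z \<in> q"
          from Kq[OF this] obtain u v where "snd z = {u..v}" "Inf (snd z) = u" "Sup (snd z) = v" "u \<le> v"
            by blast
          then show "(case z of (x, K) \<Rightarrow> Sup K - Inf K) = measure lebesgue (snd z)"
            by (simp add: case_prod_beta)
        qed
        also have "\<dots> = measure lebesgue (\<Union>(snd ` q))"
        proof (rule measure_negligible_finite_Union_image[symmetric])
          show "finite q" by fact
          show "snd z \<in> lmeasurable" if "z \<in> q" for z by (rule lmq[OF that])
          show "pairwise (\<lambda>z w. negligible (snd z \<inter> snd w)) q"
          proof (rule pairwiseI)
            fix z w assume zw: "z \<in> q" "w \<in> q" "z \<noteq> w"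
            obtain u v where 1: "snd z = {u..v}" using Kq[OF zw(1)] by blast
            obtain u' v' where 2: "snd w = {u'..v'}" using Kq[OF zw(2)] by blast
            have "interior (snd z \<inter> snd w) = {}" using disj[OF zw] by (simp add: interior_Int)
            then show "negligible (snd z \<inter> snd w)"
              unfolding 1 2 by (metis Int_atLeastAtMost box_real(2) negligible_interval(1) interior_cbox)
          qed
        qed
        also have "\<dots> \<le> measure lebesgue U"
        proof (rule measure_mono_fmeasurable)
          show "\<Union> (snd ` q) \<subseteq> U" using fineK by (fastforce simp: q_def \<gamma>_def)
          show "\<Union> (snd ` q) \<in> sets lebesgue"
          proof (rule sets.finite_Union)
            show "snd ` q \<subseteq> sets lebesgue" using lmq fmeasurableD by blast
          qed (use \<open>finite q\<close> in auto)
        qed (use lU in auto)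
        also have "\<dots> < \<eta>" by (rule mU)
        finally have len: "(\<Sum>i<card q. Sup (k i) - Inf (k i)) < \<eta>"
          using re[of "\<lambda>u v. v - u"] by simp
        have "(\<Sum>i<card q. dist (f (Inf (k i))) (f (Sup (k i)))) < e / 2"
        proof (rule \<eta>0[rule_format, OF conjI[OF _ conjI[OF _ len]]]; intro allI impI)
          fix i assume i: "i < card q"
          then obtain x where "(x, k i) \<in> q" using kK by blast
          then have "(x, k i) \<in> p" using \<open>q \<subseteq> p\<close> by blast
          from K[OF this] show "a \<le> Inf (k i) \<and> Inf (k i) \<le> Sup (k i) \<and> Sup (k i) \<le> b" by auto
          fix j assume j: "j < card q" and "i \<noteq> j"
          then obtain y where y: "(y, k j) \<in> q" using kK by blast
          obtain u v where 1: "k i = {u..v}" "Inf (k i) = u" "Sup (k i) = v" "u < v"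
            using K[OF \<open>(x, k i) \<in> p\<close>] \<open>(x, k i) \<in> q\<close> unfolding q_def by auto
          obtain u' v' where 2: "k j = {u'..v'}" "Inf (k j) = u'" "Sup (k j) = v'" "u' < v'"
            using K[of y "k j"] y unfolding q_def by auto
          have "h i \<noteq> h j" using h i j \<open>i \<noteq> j\<close> by (auto simp: bij_betw_def inj_on_def)
          then have "interior (k i) \<inter> interior (k j) = {}" using disj hq i j by (simp add: k_def)
          then have "max u u' \<ge> min v v'"
            unfolding 1 2 interior_atLeastAtMost_real by (metis Int_greaterThanLessThan greaterThanLessThan_empty_iff)
          then have "v \<le> u' \<or> v' \<le> u" using 1(4) 2(4) by linarith
          then show "Sup (k i) \<le> Inf (k j) \<or> Sup (k j) \<le> Inf (k i)"
            using 1(2,3) 2(2,3) by blast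
        qed
        then show ?thesis using re[of "\<lambda>u v. dist (f u) (f v)"] by simp
      qed
      have "(\<Sum>(x, k)\<in>p. measure lborel k *\<^sub>R g x) - (f b - f a)
          = (\<Sum>(x, K)\<in>p. measure lborel K *\<^sub>R g x - (f (Sup K) - f (Inf K)))"
        by (simp add: ba split_def sum_subtractf)
      also have "\<dots> = (\<Sum>(x, K)\<in>p - q. measure lborel K *\<^sub>R g x - (f (Sup K) - f (Inf K)))
          + (\<Sum>(x, K)\<in>q. measure lborel K *\<^sub>R g x - (f (Sup K) - f (Inf K)))"
        using sum.subset_diff[OF \<open>q \<subseteq> p\<close> finp] by blast
      also have "norm \<dots> \<le> (\<Sum>(x, K)\<in>p - q. e1 * (Sup K - Inf K)) + (\<Sum>(x, K)\<in>q. dist (f (Inf K)) (f (Sup K)))"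
      proof (rule norm_triangle_mono; rule sum_norm_le)
        fix z assume "z \<in> p - q"
        then show "norm (case z of (x, K) \<Rightarrow> measure lborel K *\<^sub>R g x - (f (Sup K) - f (Inf K)))
          \<le> (case z of (x, K) \<Rightarrow> e1 * (Sup K - Inf K))"
          using good by (cases z) auto
      next
        fix z assume "z \<in> q"
        then show "norm (case z of (x, K) \<Rightarrow> measure lborel K *\<^sub>R g x - (f (Sup K) - f (Inf K)))
          \<le> (case z of (x, K) \<Rightarrow> dist (f (Inf K)) (f (Sup K)))"
          by (cases z) (auto simp: q_def g_def dist_norm norm_minus_commute)
      qed
      also have "(\<Sum>(x, K)\<in>p - q. e1 * (Sup K - Inf K)) \<le> (\<Sum>(x, K)\<in>p. e1 * (Sup K - Inf K))"
      proof (rule sum_mono2[OF finp])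
        fix z assume "z \<in> p - (p - q)"
        then show "0 \<le> (case z of (x, K) \<Rightarrow> e1 * (Sup K - Inf K))"
          using K[of "fst z" "snd z"] \<open>e1 > 0\<close> by (auto simp: case_prod_beta)
      qed auto
      also have "\<dots> = e1 * (b - a)"
        unfolding ba(1) by (simp add: sum_distrib_left case_prod_beta)
      finally show ?case using bad e1 by linarith
    qed
  qed
  then have "(g has_integral (f b - f a)) {a..b}" by simp
  then show ?thesis
    by (rule has_integral_spike[OF N, rotated]) (auto simp: g_def)
qed

section \<open>Lower bounds for the Carnot-Caratheodory distance\<close>

lemma powr_diff_le:
  fixes a b R p :: real
  assumes "0 \<le> a" "a \<le> R" "0 \<le> b" "b \<le> R" "1 \<le> p"
  shows "\<bar>a powr p - b powr p\<bar> \<le> p * R powr (p - 1) * \<bar>a - b\<bar>"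
proof -
  have *: "\<bar>b powr p - a powr p\<bar> \<le> p * R powr (p - 1) * \<bar>b - a\<bar>"
    if "0 \<le> a" "a < b" "b \<le> R" for a b :: real
  proof -
    have "continuous_on {a..b} (\<lambda>x. x powr p)"
      using that assms by (intro continuous_intros continuous_on_powr') auto
    moreover have "((\<lambda>x. x powr p) has_real_derivative p * x powr (p - 1)) (at x)"
      if "a < x" "x < b" for x
      using that \<open>0 \<le> a\<close> by (intro has_real_derivative_powr) auto
    ultimately obtain x where x: "a < x" "x < b" "b powr p - a powr p = (b - a) * (p * x powr (p - 1))"
      using mvt[of a b "\<lambda>x. x powr p" "\<lambda>x h. (p * x powr (p - 1)) * h"] \<open>a < b\<close>
      unfolding has_field_derivative_def by (metis mult.commute)
    have "x powr (p - 1) \<le> R powr (p - 1)"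
      using x that assms by (intro powr_mono2) auto
    then have "(b - a) * (p * x powr (p - 1)) \<le> (b - a) * (p * R powr (p - 1))"
      using that assms by (intro mult_left_mono) auto
    moreover have "0 \<le> (b - a) * (p * x powr (p - 1))" using that assms by simp
    ultimately show ?thesis using x that by (simp add: mult_ac)
  qed
  show ?thesis
    using *[of a b] *[of b a] assms by (cases a b rule: linorder_cases) (auto simp: abs_minus_commute)
qed

section \<open>The form that gives the t-component of horizontal velocities\<close>

definition omega :: "real \<Rightarrow> real \<times> real \<Rightarrow> real \<times> real" where
  "omega m z = norm z powr (2 * m) *\<^sub>R (snd z, - fst z)"

lemma norm_rot: "norm (snd z, - fst z :: real) = norm (z :: real \<times> real)"
  by (simp add: norm_prod_def add.commute)

text \<open>The product rule in integrated form: the increment of the rotated vector contributes 1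
  to the constant and the increment of the weight contributes 2m.\<close>

lemma omega_diff_le:
  assumes "m \<ge> 1" "norm (w - z) \<le> r"
  shows "norm (omega m w - omega m z) \<le> (2 * m + 1) * r * (norm z + r) powr (2 * m)"
proof -
  define R where "R = norm z + r"
  have "r \<ge> 0" using assms(2) norm_ge_zero order_trans by blast
  have R: "norm z \<le> R" "norm w \<le> R"
    using assms(2) \<open>r \<ge> 0\<close> norm_triangle_sub[of w z] by (auto simp: R_def)
  then have "R \<ge> 0" using norm_ge_zero order_trans by blast
  have "omega m w - omega m z = norm w powr (2 * m) *\<^sub>R (snd (w - z), - fst (w - z))
       + (norm w powr (2 * m) - norm z powr (2 * m)) *\<^sub>R (snd z, - fst z)"
    by (simp add: omega_def prod_eq_iff algebra_simps)
  then have "norm (omega m w - omega m z) \<le> norm w powr (2 * m) * norm (w - z)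
       + \<bar>norm w powr (2 * m) - norm z powr (2 * m)\<bar> * norm z"
    by (metis norm_rot norm_scaleR norm_triangle_ineq abs_of_nonneg powr_ge_zero)
  also have "\<dots> \<le> R powr (2 * m) * r + (2 * m * R powr (2 * m - 1) * r) * R"
  proof (intro add_mono mult_mono)
    have "\<bar>norm w powr (2 * m) - norm z powr (2 * m)\<bar>
        \<le> 2 * m * R powr (2 * m - 1) * \<bar>norm w - norm z\<bar>"
      using R assms by (intro powr_diff_le) auto
    also have "\<dots> \<le> 2 * m * R powr (2 * m - 1) * r"
      using assms norm_triangle_ineq3[of w z] by (intro mult_left_mono) auto
    finally show "\<bar>norm w powr (2 * m) - norm z powr (2 * m)\<bar> \<le> 2 * m * R powr (2 * m - 1) * r" .
  qed (use R assms \<open>r \<ge> 0\<close> in \<open>auto intro!: powr_mono2\<close>)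
  also have "\<dots> = (2 * m + 1) * r * R powr (2 * m)"
    using powr_mult_base[OF \<open>R \<ge> 0\<close>, of "2 * m - 1"] by (simp add: algebra_simps)
  finally show ?thesis by (simp add: R_def)
qed

definition zc :: "pt \<Rightarrow> real \<times> real" where "zc p = (fst p, fst (snd p))"
definition tc :: "pt \<Rightarrow> real" where "tc p = snd (snd p)"

lemma bounded_linear_zc: "bounded_linear zc"
  unfolding zc_def by (intro bounded_linear_Pair bounded_linear_fst
      bounded_linear_compose[OF bounded_linear_fst bounded_linear_snd])

lemma bounded_linear_tc: "bounded_linear tc"
  unfolding tc_def by (intro bounded_linear_compose[OF bounded_linear_snd bounded_linear_snd])

lemma pt_eq_iff: "p = q \<longleftrightarrow> zc p = zc q \<and> tc p = tc q"
  by (auto simp: zc_def tc_def prod_eq_iff)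

lemma norm_powr_double: "norm (x, y) powr (2 * m) = (x\<^sup>2 + y\<^sup>2) powr m" for x y :: real
  using powr_powr[of "norm (x, y)" 2 m] by (simp add: norm_prod_def)

lemma horizontal_field: "a *\<^sub>R Xf m p + b *\<^sub>R Yf m p = (a, b, omega m (zc p) \<bullet> (a, b))"
proof (cases p)
  case (fields x y t)
  define w where "w = (x\<^sup>2 + y\<^sup>2) powr m"
  have "norm (x, y) powr (2 * m) = w" by (simp add: w_def norm_powr_double)
  then have "omega m (zc p) = (w * y, - (w * x))" by (simp add: fields zc_def omega_def)
  moreover have "Xf m p = (1, 0, w * y)" "Yf m p = (0, 1, - (w * x))"
    by (simp_all add: fields Xf_def Yf_def w_def)
  ultimately show ?thesis by (simp add: algebra_simps)
qed

lemma abs_continuous_on_subset: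
  assumes "abs_continuous_on a b f" "a \<le> c" "d \<le> b"
  shows "abs_continuous_on c d f"
  unfolding abs_continuous_on_def
proof (intro allI impI)
  fix e :: real assume "e > 0"
  with assms(1) obtain \<eta> where "\<eta> > 0" and \<eta>: "\<forall>(n::nat) (u::nat\<Rightarrow>real) v. (\<forall>i<n. a \<le> u i \<and> u i \<le> v i \<and> v i \<le> b) \<and>
        (\<forall>i<n. \<forall>j<n. i \<noteq> j \<longrightarrow> v i \<le> u j \<or> v j \<le> u i) \<and>
        (\<Sum>i<n. v i - u i) < \<eta> \<longrightarrow> (\<Sum>i<n. dist (f (u i)) (f (v i))) < e"
    unfolding abs_continuous_on_def by blast
  show "\<exists>\<eta>>0. \<forall>(n::nat) (u::nat\<Rightarrow>real) v. (\<forall>i<n. c \<le> u i \<and> u i \<le> v i \<and> v i \<le> d) \<and>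
        (\<forall>i<n. \<forall>j<n. i \<noteq> j \<longrightarrow> v i \<le> u j \<or> v j \<le> u i) \<and>
        (\<Sum>i<n. v i - u i) < \<eta> \<longrightarrow> (\<Sum>i<n. dist (f (u i)) (f (v i))) < e"
  proof (rule exI[of _ \<eta>], intro conjI allI impI \<open>\<eta> > 0\<close>)
    fix n :: nat and u v :: "nat \<Rightarrow> real"
    assume uv: "(\<forall>i<n. c \<le> u i \<and> u i \<le> v i \<and> v i \<le> d) \<and>
        (\<forall>i<n. \<forall>j<n. i \<noteq> j \<longrightarrow> v i \<le> u j \<or> v j \<le> u i) \<and> (\<Sum>i<n. v i - u i) < \<eta>"
    then have "\<forall>i<n. a \<le> u i \<and> u i \<le> v i \<and> v i \<le> b"
      using assms(2,3) by (meson order_trans)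
    with uv show "(\<Sum>i<n. dist (f (u i)) (f (v i))) < e"
      using \<eta>[rule_format, of n u v] by blast
  qed
qed

text \<open>The strict inequality supplies a curve of length below r, which stays over the disc of
  radius r about \<open>zc p\<close>. Freezing \<open>omega\<close> at p leaves an error whose
  t-velocity is (omega(z) - omega(z_p)) . v, at most the constant of \<open>omega_diff_le\<close>
  times |v|; integrating |v| gives the second factor r.\<close>

lemma cc_dist_lessD:
  assumes "m \<ge> 1" and less: "cc_dist m p q < ennreal r"
  shows "norm (zc q - zc p) \<le> r"
    and "\<bar>tc q - tc p - omega m (zc p) \<bullet> (zc q - zc p)\<bar> \<le> (2 * m + 1) * r\<^sup>2 * (norm (zc p) + r) powr (2 * m)"
proof -
  obtain \<gamma> \<alpha> \<beta> where hor: "horizontal_with m \<gamma> \<alpha> \<beta>" and [simp]: "\<gamma> 0 = p" "\<gamma> 1 = q"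
    and len: "ctrl_length \<alpha> \<beta> < ennreal r"
    using less unfolding cc_dist_def INF_less_iff by blast
  have "r > 0" using len by (metis ennreal_neg not_le not_less_zero)
  define g where "g s = (\<alpha> s, \<beta> s, omega m (zc (\<gamma> s)) \<bullet> (\<alpha> s, \<beta> s))" for s
  define v where "v s = (\<alpha> s, \<beta> s)" for s
  have ac: "abs_continuous_on 0 1 \<gamma>"
    and AE: "AE s in lebesgue_on {0..1}. (\<gamma> has_vector_derivative g s) (at s within {0..1})"
    using hor by (auto simp: horizontal_with_def g_def horizontal_field)
  obtain N where N: "N \<in> null_sets (lebesgue_on {0..1})"
    "{s \<in> space (lebesgue_on {0..1}). \<not> (\<gamma> has_vector_derivative g s) (at s within {0..1})} \<subseteq> N"
    using AE unfolding eventually_ae_filter by blast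
  have "negligible N" using N(1) by (simp add: null_sets_restrict_space negligible_iff_null_sets)
  \<comment> \<open>The identity is needed at every time s, because \<open>omega_diff_le\<close> is
    applied along the whole curve and not only at its end point.\<close>
  have gint: "(g has_integral (\<gamma> s - p)) {0..s}" if s: "s \<in> {0..1}" for s
  proof -
    have "(g has_integral (\<gamma> s - \<gamma> 0)) {0..s}"
    proof (rule has_integral_abs_continuous_on[OF _ _ \<open>negligible N\<close>])
      show "abs_continuous_on 0 s \<gamma>" using ac by (rule abs_continuous_on_subset) (use s in auto)
      fix x assume "x \<in> {0..s} - N"
      then have "(\<gamma> has_vector_derivative g x) (at x within {0..1})" using N(2) s by auto
      then show "(\<gamma> has_vector_derivative g x) (at x within {0..s})"
        by (rule has_vector_derivative_within_subset) (use s in auto)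
    qed (use s in auto)
    then show ?thesis by simp
  qed
  have vg: "v = zc \<circ> g" by (auto simp: v_def zc_def g_def)
  have vint: "(v has_integral (zc (\<gamma> s) - zc p)) {0..s}" if "s \<in> {0..1}" for s
    using has_integral_linear[OF gint[OF that] bounded_linear_zc]
    by (simp add: vg linear_diff bounded_linear_zc bounded_linear.linear)
  \<comment> \<open>Measurability of the controls is not part of \<open>horizontal_with\<close>; it
    is recovered from gauge integrability. Together with the finite length it makes |v| integrable,
    so that the length becomes an ordinary integral \<open>l\<close>.\<close>
  have "v integrable_on {0..1}" using vint[of 1] by auto
  then have vm: "v \<in> borel_measurable (lebesgue_on {0..1})"
    by (rule integrable_imp_measurable)
  have ctrl: "ctrl_length \<alpha> \<beta> = (\<integral>\<^sup>+ s. ennreal (norm (v s)) \<partial>lebesgue_on {0..1})"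
    by (simp add: ctrl_length_def v_def norm_prod_def)
  have "integrable (lebesgue_on {0..1}) v"
  proof (rule integrableI_bounded[OF vm])
    show "(\<integral>\<^sup>+ s. ennreal (norm (v s)) \<partial>lebesgue_on {0..1}) < \<infinity>"
      using len ctrl by (metis ennreal_less_top infinity_ennreal_def less_trans)
  qed
  then have nvi: "integrable (lebesgue_on {0..1}) (\<lambda>s. norm (v s))" by (rule integrable_norm)
  define l where "l = integral {0..1} (\<lambda>s. norm (v s))"
  have "ctrl_length \<alpha> \<beta> = ennreal (LINT s|lebesgue_on {0..1}. norm (v s))"
    unfolding ctrl using nvi by (intro nn_integral_eq_integral) auto
  also have "(LINT s|lebesgue_on {0..1}. norm (v s)) = l"
    using nvi by (simp add: l_def lebesgue_integral_eq_integral)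
  finally have "l \<le> r" using len \<open>r > 0\<close> using ennreal_leI[of r l] by (force simp: not_le[symmetric])
  have nv: "(\<lambda>s. norm (v s)) integrable_on {0..1}"
    using integrable_on_lebesgue_on[OF nvi] by simp
  have dist: "norm (zc (\<gamma> s) - zc p) \<le> r" if s: "s \<in> {0..1}" for s
  proof -
    have sub: "(\<lambda>s. norm (v s)) integrable_on {0..s}"
      by (rule integrable_on_subinterval[OF nv]) (use s in auto)
    have "norm (integral {0..s} v) \<le> integral {0..s} (\<lambda>s. norm (v s))"
      using vint[OF s] sub by (intro integral_norm_bound_integral) auto
    also have "\<dots> \<le> l"
      unfolding l_def using s nv sub by (intro integral_subset_le) auto
    finally show ?thesis using vint[OF s] \<open>l \<le> r\<close> by (simp add: integral_unique)
  qed
  show "norm (zc q - zc p) \<le> r" using dist[of 1] by simp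
  define c where "c = (2 * m + 1) * r * (norm (zc p) + r) powr (2 * m)"
  have "c \<ge> 0" using assms \<open>r > 0\<close> by (simp add: c_def)
  define h where "h s = (omega m (zc (\<gamma> s)) - omega m (zc p)) \<bullet> v s" for s
  have "((\<lambda>s. tc (g s) - omega m (zc p) \<bullet> zc (g s)) has_integral
      (tc (q - p) - omega m (zc p) \<bullet> zc (q - p))) {0..1}"
    using has_integral_linear[OF gint[of 1], of "\<lambda>p'. tc p' - omega m (zc p) \<bullet> zc p'"]
      bounded_linear_sub[OF bounded_linear_tc bounded_linear_compose[OF bounded_linear_inner_right bounded_linear_zc]]
    by (simp add: o_def)
  moreover have "tc (g s) - omega m (zc p) \<bullet> zc (g s) = h s" for s
    by (simp add: g_def h_def v_def tc_def zc_def inner_diff_left)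
  ultimately have hint: "(h has_integral (tc q - tc p - omega m (zc p) \<bullet> (zc q - zc p))) {0..1}"
    by (simp add: tc_def zc_def)
  have "norm (integral {0..1} h) \<le> integral {0..1} (\<lambda>s. c * norm (v s))"
  proof (rule integral_norm_bound_integral)
    fix s :: real assume s: "s \<in> {0..1}"
    have "norm (h s) \<le> norm (omega m (zc (\<gamma> s)) - omega m (zc p)) * norm (v s)"
      unfolding h_def real_norm_def by (rule Cauchy_Schwarz_ineq2)
    also have "\<dots> \<le> c * norm (v s)"
      unfolding c_def using dist[OF s] assms by (intro mult_right_mono omega_diff_le) auto
    finally show "norm (h s) \<le> c * norm (v s)" .
  qed (use hint nv in \<open>auto intro!: integrable_on_mult_right\<close>)
  also have "\<dots> = c * l" by (simp add: l_def)
  also have "\<dots> \<le> c * r" using \<open>c \<ge> 0\<close> \<open>l \<le> r\<close> by (rule mult_left_mono[rotated])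
  finally show "\<bar>tc q - tc p - omega m (zc p) \<bullet> (zc q - zc p)\<bar> \<le> (2 * m + 1) * r\<^sup>2 * (norm (zc p) + r) powr (2 * m)"
    using hint by (simp add: integral_unique c_def power2_eq_square mult_ac)
qed

section \<open>Upper bounds for the Carnot-Caratheodory distance\<close>

lemma abs_continuous_on_bounded_derivative:
  fixes f :: "real \<Rightarrow> 'a::banach"
  assumes cont: "continuous_on {a..b} f" and "finite F"
    and deriv: "\<And>s. s \<in> {a..b} - F \<Longrightarrow> (f has_vector_derivative g s) (at s)"
    and bound: "\<And>s. s \<in> {a..b} \<Longrightarrow> norm (g s) \<le> K" and "K \<ge> 0"
  shows "abs_continuous_on a b f"
  unfolding abs_continuous_on_def
proof (intro allI impI)
  fix e :: real assume "e > 0"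
  have lip: "dist (f u) (f v) \<le> K * (v - u)" if "a \<le> u" "u \<le> v" "v \<le> b" for u v
  proof -
    have "(g has_integral (f v - f u)) {u..v}"
      using that cont by (intro fundamental_theorem_of_calculus_strong[OF \<open>finite F\<close>])
        (auto intro: deriv continuous_on_subset)
    then show ?thesis
      using has_integral_bound[of K g "f v - f u" u v] that bound \<open>K \<ge> 0\<close>
      by (auto simp: dist_norm norm_minus_commute)
  qed
  show "\<exists>d>0. \<forall>(n::nat) (u::nat\<Rightarrow>real) v. (\<forall>i<n. a \<le> u i \<and> u i \<le> v i \<and> v i \<le> b) \<and>
        (\<forall>i<n. \<forall>j<n. i \<noteq> j \<longrightarrow> v i \<le> u j \<or> v j \<le> u i) \<and>
        (\<Sum>i<n. v i - u i) < d \<longrightarrow> (\<Sum>i<n. dist (f (u i)) (f (v i))) < e"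
  proof (intro exI[of _ "e / (K + 1)"] conjI allI impI; (elim conjE)?)
    show "0 < e / (K + 1)" using \<open>e > 0\<close> \<open>K \<ge> 0\<close> by simp
    fix n :: nat and u v :: "nat \<Rightarrow> real"
    assume uv: "\<forall>i<n. a \<le> u i \<and> u i \<le> v i \<and> v i \<le> b" and sum: "(\<Sum>i<n. v i - u i) < e / (K + 1)"
    have "(\<Sum>i<n. v i - u i) \<ge> 0" using uv by (intro sum_nonneg) auto
    have "(\<Sum>i<n. dist (f (u i)) (f (v i))) \<le> (\<Sum>i<n. K * (v i - u i))"
      using uv by (intro sum_mono lip) auto
    also have "\<dots> = K * (\<Sum>i<n. v i - u i)" by (simp add: sum_distrib_left)
    also have "\<dots> \<le> (K + 1) * (\<Sum>i<n. v i - u i)"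
      using \<open>(\<Sum>i<n. v i - u i) \<ge> 0\<close> by (intro mult_right_mono) auto
    also have "\<dots> < e" using sum \<open>K \<ge> 0\<close> by (simp add: field_simps)
    finally show "(\<Sum>i<n. dist (f (u i)) (f (v i))) < e" .
  qed
qed

lemma norm_omega: "m \<ge> 0 \<Longrightarrow> norm (omega m z) = norm z powr (2 * m + 1)"
  using powr_mult_base[of "norm z" "2 * m"] unfolding omega_def norm_scaleR norm_rot by (simp add: mult.commute add.commute)

text \<open>Explicit curves enter through this lemma, with \<open>F\<close> the set of corner times.
  Absolute continuity follows from a Lipschitz bound: z stays in a compact set, so the t-velocity is
  bounded as soon as the controls are.\<close>

lemma cc_dist_le_length:
  assumes "m \<ge> 0" and cont: "continuous_on {0..1} \<gamma>" and ends: "\<gamma> 0 = p" "\<gamma> 1 = q" and "finite F"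
    and deriv: "\<And>s. s \<in> {0..1} - F \<Longrightarrow>
       (\<gamma> has_vector_derivative (\<alpha> s, \<beta> s, omega m (zc (\<gamma> s)) \<bullet> (\<alpha> s, \<beta> s))) (at s)"
    and len: "\<And>s. s \<in> {0..1} \<Longrightarrow> norm (\<alpha> s, \<beta> s) \<le> L"
  shows "cc_dist m p q \<le> ennreal L"
proof -
  define g where "g s = (\<alpha> s, \<beta> s, omega m (zc (\<gamma> s)) \<bullet> (\<alpha> s, \<beta> s))" for s
  have "L \<ge> 0" using order_trans[OF norm_ge_zero len[of 0]] by simp
  have "continuous_on {0..1} (\<lambda>s. norm (zc (\<gamma> s)))"
    by (intro continuous_on_norm bounded_linear.continuous_on[OF bounded_linear_zc] cont)
  then have "compact ((\<lambda>s. norm (zc (\<gamma> s))) ` {0..1})"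
    by (rule compact_continuous_image) auto
  then have "bounded ((\<lambda>s. norm (zc (\<gamma> s))) ` {0..1})" by (rule compact_imp_bounded)
  then obtain M where "\<forall>x\<in>(\<lambda>s. norm (zc (\<gamma> s))) ` {0..1}. norm x \<le> M"
    unfolding bounded_iff by blast
  then have M: "norm (zc (\<gamma> s)) \<le> M" if "s \<in> {0..1}" for s using that by auto
  have gb: "norm (g s) \<le> L + L + M powr (2 * m + 1) * L" if s: "s \<in> {0..1}" for s
  proof -
    have "norm (omega m (zc (\<gamma> s))) \<le> M powr (2 * m + 1)"
      using M[OF s] \<open>m \<ge> 0\<close> by (simp add: norm_omega powr_mono2)
    then have "\<bar>omega m (zc (\<gamma> s)) \<bullet> (\<alpha> s, \<beta> s)\<bar> \<le> M powr (2 * m + 1) * L"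
      by (intro order_trans[OF Cauchy_Schwarz_ineq2] mult_mono len[OF s]) auto
    moreover have "\<bar>\<alpha> s\<bar> \<le> L" "\<bar>\<beta> s\<bar> \<le> L"
      using len[OF s] norm_fst_le[of "\<alpha> s" "\<beta> s"] norm_snd_le[of "\<beta> s" "\<alpha> s"] by auto
    moreover have "norm (g s) \<le> \<bar>\<alpha> s\<bar> + (\<bar>\<beta> s\<bar> + \<bar>omega m (zc (\<gamma> s)) \<bullet> (\<alpha> s, \<beta> s)\<bar>)"
      unfolding g_def using norm_Pair_le[of "\<alpha> s" "(\<beta> s, omega m (zc (\<gamma> s)) \<bullet> (\<alpha> s, \<beta> s))"]
        norm_Pair_le[of "\<beta> s" "omega m (zc (\<gamma> s)) \<bullet> (\<alpha> s, \<beta> s)"] by simp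
    ultimately show ?thesis by linarith
  qed
  have "abs_continuous_on 0 1 \<gamma>"
    using deriv
    by (intro abs_continuous_on_bounded_derivative[OF cont \<open>finite F\<close> _ gb])
      (use \<open>L \<ge> 0\<close> in \<open>auto simp: g_def\<close>)
  moreover have "AE s in lebesgue_on {0..1}. (\<gamma> has_vector_derivative g s) (at s within {0..1})"
  proof (rule AE_I')
    show "F \<inter> {0..1} \<in> null_sets (lebesgue_on {0..1})"
      using \<open>finite F\<close> by (simp add: null_sets_restrict_space negligible_finite flip: negligible_iff_null_sets)
    show "{s \<in> space (lebesgue_on {0..1}). \<not> (\<gamma> has_vector_derivative g s) (at s within {0..1})} \<subseteq> F \<inter> {0..1}"
      using deriv by (auto simp: g_def intro: has_vector_derivative_at_within)
  qed
  ultimately have "horizontal_with m \<gamma> \<alpha> \<beta>"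
    by (simp add: horizontal_with_def horizontal_field g_def)
  then have "cc_dist m p q \<le> ctrl_length \<alpha> \<beta>"
    unfolding cc_dist_def by (intro INF_lower) (use ends in blast)
  also have "\<dots> \<le> (\<integral>\<^sup>+ s. ennreal L \<partial>lebesgue_on {0..1::real})"
    unfolding ctrl_length_def
  proof (rule nn_integral_mono)
    fix s :: real assume "s \<in> space (lebesgue_on {0..1})"
    then show "ennreal (sqrt ((\<alpha> s)\<^sup>2 + (\<beta> s)\<^sup>2)) \<le> ennreal L"
      using len[of s] by (intro ennreal_leI) (simp add: norm_prod_def)
  qed
  also have "\<dots> = ennreal L" by (simp add: emeasure_restrict_space)
  finally show ?thesis .
qed

lemma cc_dist_refl [simp]: "m \<ge> 0 \<Longrightarrow> cc_dist m p p = 0"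
  using cc_dist_le_length[of m "\<lambda>_. p" p p "{}" "\<lambda>_. 0" "\<lambda>_. 0" 0]
  by (simp add: zero_prod_def[symmetric])

section \<open>Explicit horizontal curves made of radial segments and arcs\<close>

definition clamp01 :: "real \<Rightarrow> real" where "clamp01 x = max 0 (min 1 x)"

lemma clamp01_simps: "x \<le> 0 \<Longrightarrow> clamp01 x = 0" "1 \<le> x \<Longrightarrow> clamp01 x = 1"
  "0 \<le> x \<Longrightarrow> x \<le> 1 \<Longrightarrow> clamp01 x = x"
  by (auto simp: clamp01_def)

lemma continuous_on_clamp01 [continuous_intros]:
  "continuous_on S f \<Longrightarrow> continuous_on S (\<lambda>s. clamp01 (f s))"
  unfolding clamp01_def by (intro continuous_intros)

lemma has_real_derivative_clamp01:
  assumes "x \<noteq> 0" "x \<noteq> 1"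
  shows "(clamp01 has_real_derivative (if 0 < x \<and> x < 1 then 1 else 0)) (at x)"
proof -
  consider "x < 0" | "0 < x" "x < 1" | "1 < x" using assms by linarith
  then show ?thesis
  proof cases
    case 1
    have "((\<lambda>_. 0) has_real_derivative 0) (at x)" by simp
    then have "(clamp01 has_real_derivative 0) (at x)"
      by (rule has_field_derivative_transform_within_open[where S = "{..<0}"]) (use 1 in \<open>auto simp: clamp01_simps\<close>)
    then show ?thesis using 1 by simp
  next
    case 2
    have "((\<lambda>x. x) has_real_derivative 1) (at x)" by simp
    then have "(clamp01 has_real_derivative 1) (at x)"
      by (rule has_field_derivative_transform_within_open[where S = "{0<..<1}"]) (use 2 in \<open>auto simp: clamp01_simps\<close>)
    then show ?thesis using 2 by simp
  next
    case 3
    have "((\<lambda>_. 1) has_real_derivative 0) (at x)" by simp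
    then have "(clamp01 has_real_derivative 0) (at x)"
      by (rule has_field_derivative_transform_within_open[where S = "{1<..}"]) (use 3 in \<open>auto simp: clamp01_simps\<close>)
    then show ?thesis using 3 by simp
  qed
qed

text \<open>
  On a horizontal curve the change of t is minus the integral of \<open>\<bar>z\<bar> powr (2 * m + 2)\<close> against
  the polar angle, so radial segments are free. The curve below consists of a radial segment to radius
  \<open>R\<close>, an arc of angle \<open>A\<close>, a radial segment to radius \<open>\<rho>'\<close> and an arc of angle \<open>B\<close>,
  each run in a quarter of the unit interval.
\<close>

lemma cc_dist_polar_le:
  assumes "m \<ge> 0" "\<rho> \<ge> 0" "R \<ge> 0" "\<rho>' \<ge> 0"
  shows "cc_dist m (\<rho> * cos a, \<rho> * sin a, t)
      (\<rho>' * cos (a + A + B), \<rho>' * sin (a + A + B), t - R powr (2 * m + 2) * A - \<rho>' powr (2 * m + 2) * B)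
     \<le> ennreal (4 * (\<bar>R - \<rho>\<bar> + R * \<bar>A\<bar> + \<bar>\<rho>' - R\<bar> + \<rho>' * \<bar>B\<bar>))"
proof -
  \<comment> \<open>\<open>c k\<close> rises from 0 to 1 during the quarter number k, counted from
    0, and \<open>e k\<close> is its derivative away from the corners. One formula then describes
    all four pieces, and continuity needs no gluing.\<close>
  define c where "c k s = clamp01 (4 * s - k)" for k s :: real
  define e where "e k s = (if k < 4 * s \<and> 4 * s < k + 1 then 4 else 0 :: real)" for k s :: real
  define rad where "rad s = \<rho> + (R - \<rho>) * c 0 s + (\<rho>' - R) * c 2 s" for s
  define th where "th s = a + A * c 1 s + B * c 3 s" for s
  define rad' where "rad' s = (R - \<rho>) * e 0 s + (\<rho>' - R) * e 2 s" for s
  define th' where "th' s = A * e 1 s + B * e 3 s" for s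
  define \<gamma> where "\<gamma> s = (rad s * cos (th s), rad s * sin (th s),
     t - R powr (2 * m + 2) * A * c 1 s - \<rho>' powr (2 * m + 2) * B * c 3 s)" for s
  define \<alpha> where "\<alpha> s = rad' s * cos (th s) - rad s * sin (th s) * th' s" for s
  define \<beta> where "\<beta> s = rad' s * sin (th s) + rad s * cos (th s) * th' s" for s
  define L where "L = 4 * (\<bar>R - \<rho>\<bar> + R * \<bar>A\<bar> + \<bar>\<rho>' - R\<bar> + \<rho>' * \<bar>B\<bar>)"
  \<comment> \<open>Radius and angle never move together: while the angle changes, the radius is
    \<open>R\<close> in quarter 1 and \<open>\<rho>'\<close> in quarter 3. Hence the t-velocity is a
    constant times the angular speed, and t can be integrated in closed form.\<close>
  have rad1: "rad s = R" if "e 1 s \<noteq> 0" for s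
    using that by (auto simp: rad_def e_def c_def clamp01_simps split: if_splits)
  have rad3: "rad s = \<rho>'" if "e 3 s \<noteq> 0" for s
    using that by (auto simp: rad_def e_def c_def clamp01_simps split: if_splits)
  have zc\<gamma>: "zc (\<gamma> s) = (rad s * cos (th s), rad s * sin (th s))" for s
    by (simp add: zc_def \<gamma>_def)
  have nz: "norm (x * cos u, x * sin u) = \<bar>x\<bar>" for x u :: real
  proof -
    have "(x * cos u)\<^sup>2 + (x * sin u)\<^sup>2 = x\<^sup>2"
      by (simp add: power_mult_distrib flip: distrib_left)
    then show ?thesis by (simp add: norm_prod_def)
  qed
  have t': "omega m (zc (\<gamma> s)) \<bullet> (\<alpha> s, \<beta> s)
      = - (R powr (2 * m + 2) * A * e 1 s) - \<rho>' powr (2 * m + 2) * B * e 3 s" for s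
  proof -
    have "omega m (zc (\<gamma> s)) \<bullet> (\<alpha> s, \<beta> s)
        = \<bar>rad s\<bar> powr (2 * m) * ((rad s * sin (th s)) * \<alpha> s - (rad s * cos (th s)) * \<beta> s)"
      by (simp add: omega_def zc\<gamma> nz algebra_simps)
    also have "(rad s * sin (th s)) * \<alpha> s - (rad s * cos (th s)) * \<beta> s
        = - ((rad s)\<^sup>2 * th' s) * ((sin (th s))\<^sup>2 + (cos (th s))\<^sup>2)"
      unfolding \<alpha>_def \<beta>_def by algebra
    also have "\<bar>rad s\<bar> powr (2 * m) * (- ((rad s)\<^sup>2 * th' s) * ((sin (th s))\<^sup>2 + (cos (th s))\<^sup>2))
        = - (\<bar>rad s\<bar> powr (2 * m) * (rad s)\<^sup>2) * th' s"
      by simp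
    also have "\<bar>rad s\<bar> powr (2 * m) * (rad s)\<^sup>2 = \<bar>rad s\<bar> powr (2 * m + 2)"
      using powr_add[of "\<bar>rad s\<bar>" "2 * m" 2] by simp
    also have "- \<dots> * th' s = - (R powr (2 * m + 2) * A * e 1 s) - \<rho>' powr (2 * m + 2) * B * e 3 s"
      using rad1[of s] rad3[of s] assms by (cases "e 1 s = 0"; cases "e 3 s = 0") (auto simp: th'_def algebra_simps)
    finally show ?thesis .
  qed
  have "cc_dist m (\<gamma> 0) (\<gamma> 1) \<le> ennreal L"
  proof (rule cc_dist_le_length)
    show "continuous_on {0..1} \<gamma>"
      unfolding \<gamma>_def rad_def th_def c_def by (intro continuous_intros)
    show "finite {0, 1/4, 1/2, 3/4, 1 :: real}" by simp
    fix s :: real assume s: "s \<in> {0..1} - {0, 1/4, 1/2, 3/4, 1}"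
    have dc: "(c k has_real_derivative e k s) (at s)" if "k \<in> {0, 1, 2, 3}" for k
    proof -
      have "((\<lambda>s. clamp01 (4 * s - k)) has_real_derivative (if 0 < 4 * s - k \<and> 4 * s - k < 1 then 1 else 0) * 4) (at s)"
        using s that by (intro DERIV_chain2[OF has_real_derivative_clamp01]) (auto intro!: derivative_eq_intros)
      then show ?thesis by (auto simp: c_def[abs_def] e_def algebra_simps split: if_splits)
    qed
    note [derivative_intros] = dc[of 0, simplified] dc[of 1, simplified] dc[of 2, simplified] dc[of 3, simplified]
    have [derivative_intros]: "(rad has_real_derivative rad' s) (at s)"
      unfolding rad_def[abs_def] rad'_def by (auto intro!: derivative_eq_intros)
    have [derivative_intros]: "(th has_real_derivative th' s) (at s)"
      unfolding th_def[abs_def] th'_def by (auto intro!: derivative_eq_intros)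
    show "(\<gamma> has_vector_derivative (\<alpha> s, \<beta> s, omega m (zc (\<gamma> s)) \<bullet> (\<alpha> s, \<beta> s))) (at s)"
      unfolding t' unfolding \<gamma>_def[abs_def]
    proof (intro has_vector_derivative_Pair)
      have "((\<lambda>s. rad s * cos (th s)) has_real_derivative \<alpha> s) (at s)"
        by (auto intro!: derivative_eq_intros simp: \<alpha>_def)
      then show "((\<lambda>s. rad s * cos (th s)) has_vector_derivative \<alpha> s) (at s)"
        by (simp add: has_real_derivative_iff_has_vector_derivative)
      have "((\<lambda>s. rad s * sin (th s)) has_real_derivative \<beta> s) (at s)"
        by (auto intro!: derivative_eq_intros simp: \<beta>_def)
      then show "((\<lambda>s. rad s * sin (th s)) has_vector_derivative \<beta> s) (at s)"
        by (simp add: has_real_derivative_iff_has_vector_derivative)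
      have "((\<lambda>s. t - R powr (2 * m + 2) * A * c 1 s - \<rho>' powr (2 * m + 2) * B * c 3 s) has_real_derivative
         - (R powr (2 * m + 2) * A * e 1 s) - \<rho>' powr (2 * m + 2) * B * e 3 s) (at s)"
        by (auto intro!: derivative_eq_intros)
      then show "((\<lambda>s. t - R powr (2 * m + 2) * A * c 1 s - \<rho>' powr (2 * m + 2) * B * c 3 s) has_vector_derivative
         - (R powr (2 * m + 2) * A * e 1 s) - \<rho>' powr (2 * m + 2) * B * e 3 s) (at s)"
        by (simp add: has_real_derivative_iff_has_vector_derivative)
    qed
  next
    fix s :: real
    \<comment> \<open>The velocity splits into a radial part at angle \<open>th s\<close> and an
      angular part at that angle plus pi/2, so \<open>nz\<close> computes both norms.\<close>
    have "(\<alpha> s, \<beta> s) = (rad' s * cos (th s), rad' s * sin (th s)) + (rad s * th' s * cos (th s + pi / 2), rad s * th' s * sin (th s + pi / 2))"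
      by (simp add: \<alpha>_def \<beta>_def cos_add sin_add)
    then have "norm (\<alpha> s, \<beta> s) \<le> \<bar>rad' s\<bar> + \<bar>rad s * th' s\<bar>"
      by (metis nz norm_triangle_ineq)
    also have "\<bar>rad' s\<bar> \<le> \<bar>R - \<rho>\<bar> * 4 + \<bar>\<rho>' - R\<bar> * 4"
      unfolding rad'_def by (rule order_trans[OF abs_triangle_ineq]) (auto simp: abs_mult e_def)
    also have "\<bar>rad s * th' s\<bar> \<le> \<bar>rad s * A * e 1 s\<bar> + \<bar>rad s * B * e 3 s\<bar>"
      unfolding th'_def distrib_left by (rule order_trans[OF abs_triangle_ineq]) (auto simp: mult.assoc)
    also have "\<bar>rad s * A * e 1 s\<bar> \<le> R * \<bar>A\<bar> * 4"
      using rad1[of s] assms by (cases "e 1 s = 0") (auto simp: abs_mult e_def)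
    also have "\<bar>rad s * B * e 3 s\<bar> \<le> \<rho>' * \<bar>B\<bar> * 4"
      using rad3[of s] assms by (cases "e 3 s = 0") (auto simp: abs_mult e_def)
    finally show "norm (\<alpha> s, \<beta> s) \<le> L" by (simp add: L_def)
  qed (use assms in auto)
  then show ?thesis
    by (simp add: \<gamma>_def rad_def th_def c_def clamp01_simps L_def)
qed

section \<open>Estimates for the turning angle\<close>

lemma sin_minus_self_le: "\<bar>sin x - x\<bar> \<le> \<bar>x\<bar> ^ 3 / 6" for x :: real
  using Maclaurin_sin_bound[of x 3] by (simp add: numeral_3_eq_3 sin_coeff_def field_simps fact_numeral)

text \<open>With y = |x|/2 <= 2 one has y^3/6 <= 2y/3, hence sin y >= y/3, and 1 - cos x = 2 (sin
  y)^2. The range 4 covers angles up to pi.\<close>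

lemma one_minus_cos_ge:
  fixes x :: real
  assumes "\<bar>x\<bar> \<le> 4"
  shows "x\<^sup>2 / 18 \<le> 1 - cos x"
proof -
  define y where "y = \<bar>x\<bar> / 2"
  have y: "0 \<le> y" "y \<le> 2" using assms by (auto simp: y_def)
  have "y ^ 3 \<le> 4 * y"
    using mult_right_mono[of "y * y" 4 y] mult_mono[of y 2 y 2] y by (simp add: power3_eq_cube)
  moreover have "\<bar>sin y - y\<bar> \<le> y ^ 3 / 6" using sin_minus_self_le[of y] y by simp
  ultimately have "y / 3 \<le> sin y" by linarith
  then have "(y / 3)\<^sup>2 \<le> (sin y)\<^sup>2" using y by (intro power_mono) auto
  moreover have "cos x = 1 - 2 * (sin y)\<^sup>2"
    using cos_double_sin[of y] by (simp add: y_def)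
  ultimately show ?thesis by (simp add: y_def power_divide)
qed

text \<open>The difference of the two arguments is reduced through \<open>Arg\<close>, which gives
  the bound pi; zero vectors are covered, since every angle represents them.\<close>

lemma polar_pair:
  fixes z w :: "real \<times> real"
  obtains a \<Delta> where "z = (norm z * cos a, norm z * sin a)"
    "w = (norm w * cos (a + \<Delta>), norm w * sin (a + \<Delta>))" "\<bar>\<Delta>\<bar> \<le> pi"
proof -
  have polar: "\<exists>a. z = (norm z * cos a, norm z * sin a)" for z :: "real \<times> real"
  proof -
    have "norm z = cmod (Complex (fst z) (snd z))" by (simp add: norm_prod_def cmod_def)
    then show ?thesis
      using rcis_cmod_Arg[of "Complex (fst z) (snd z)"]
      by (intro exI[of _ "Arg (Complex (fst z) (snd z))"]) (simp add: rcis_def complex_eq_iff prod_eq_iff)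
  qed
  obtain a where a: "z = (norm z * cos a, norm z * sin a)" using polar by blast
  obtain b where b: "w = (norm w * cos b, norm w * sin b)" using polar by blast
  define \<Delta> where "\<Delta> = Arg (cis (b - a))"
  have "cis \<Delta> = cis (b - a)" by (simp add: \<Delta>_def cis_Arg sgn_eq)
  then have "cis (a + \<Delta>) = cis b" by (metis cis_mult add.commute diff_add_cancel)
  then have "cos (a + \<Delta>) = cos b" "sin (a + \<Delta>) = sin b" by (auto simp: complex_eq_iff)
  moreover have "\<bar>\<Delta>\<bar> \<le> pi"
    using Arg_bounded[of "cis (b - a)"] by (auto simp: \<Delta>_def)
  ultimately show ?thesis using that a b by metis
qed

text \<open>\<open>dist\<close> is the law of cosines for a chord of length at most r. Near the
  origin (rho <= 2r) the bound |Delta| <= 4 is enough and fixes the constant 16. Otherwise rho' >=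
  rho/2, and the quadratic lower bound for 1 - cos Delta turns the chord bound into an angle
  bound.\<close>

lemma angle_le:
  fixes \<rho> \<rho>' \<Delta> r :: real
  assumes "\<rho> \<ge> 0" "r > 0" "\<bar>\<rho>' - \<rho>\<bar> \<le> r" "\<bar>\<Delta>\<bar> \<le> pi"
    and dist: "\<rho>\<^sup>2 + \<rho>'\<^sup>2 - 2 * \<rho> * \<rho>' * cos \<Delta> \<le> r\<^sup>2"
  shows "(\<rho> + 2 * r) * \<bar>\<Delta>\<bar> \<le> 16 * r"
proof (cases "\<rho> \<le> 2 * r")
  case True
  then have "(\<rho> + 2 * r) * \<bar>\<Delta>\<bar> \<le> (4 * r) * 4"
    using assms pi_less_4 by (intro mult_mono) auto
  then show ?thesis by simp
next
  case False
  then have \<rho>': "\<rho>' \<ge> \<rho> / 2" using assms by auto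
  have "\<Delta>\<^sup>2 / 18 \<le> 1 - cos \<Delta>" using assms pi_less_4 by (intro one_minus_cos_ge) auto
  then have "2 * \<rho> * \<rho>' * (\<Delta>\<^sup>2 / 18) \<le> 2 * \<rho> * \<rho>' * (1 - cos \<Delta>)"
    using \<rho>' assms by (intro mult_left_mono) auto
  also have "\<dots> \<le> \<rho>\<^sup>2 + \<rho>'\<^sup>2 - 2 * \<rho> * \<rho>' * cos \<Delta>"
    using zero_le_power2[of "\<rho> - \<rho>'"] by (simp add: power2_eq_square algebra_simps)
  finally have 1: "\<rho> * \<rho>' * \<Delta>\<^sup>2 \<le> 9 * r\<^sup>2" using dist by simp
  have "(\<rho> + 2 * r)\<^sup>2 \<le> (2 * \<rho>)\<^sup>2" using False assms by (intro power_mono) auto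
  also have "\<dots> \<le> 8 * (\<rho> * \<rho>')"
    using mult_left_mono[OF \<rho>', of \<rho>] assms by (simp add: power2_eq_square)
  finally have "(\<rho> + 2 * r)\<^sup>2 * \<Delta>\<^sup>2 \<le> 8 * (\<rho> * \<rho>') * \<Delta>\<^sup>2" by (rule mult_right_mono) simp
  also have "\<dots> \<le> (16 * r)\<^sup>2"
  proof -
    have "8 * (\<rho> * \<rho>') * \<Delta>\<^sup>2 = 8 * (\<rho> * \<rho>' * \<Delta>\<^sup>2)" by simp
    moreover have "(16 * r)\<^sup>2 = 256 * r\<^sup>2" by (simp add: power_mult_distrib)
    ultimately show ?thesis using 1 zero_le_power2[of r] by linarith
  qed
  finally have "((\<rho> + 2 * r) * \<bar>\<Delta>\<bar>)\<^sup>2 \<le> (16 * r)\<^sup>2" by (simp add: power_mult_distrib)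
  then show ?thesis by (rule power2_le_imp_le) (use assms in simp)
qed

lemma loop_angle_le:
  fixes m \<rho> \<rho>' r \<Delta> :: real
  defines "R \<equiv> \<rho> + 2 * r"
  assumes "m \<ge> 1" "\<rho> \<ge> 0" "\<rho>' \<ge> 0" "r > 0" "\<bar>\<rho>' - \<rho>\<bar> \<le> r" "\<bar>\<Delta>\<bar> \<le> 4" "R * \<bar>\<Delta>\<bar> \<le> 16 * r"
  shows "\<bar>R powr (2 * m + 2) * \<Delta> - \<rho> powr (2 * m) * \<rho> * \<rho>' * sin \<Delta>\<bar>
     \<le> (16 * (4 * m + 5) + 256) * r\<^sup>2 * R powr (2 * m)"
proof -
  have R: "\<rho> \<le> R" "\<rho>' \<le> R" "R - \<rho>' \<le> 3 * r" "0 < R" using assms by auto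
  define c where "c = \<rho> powr (2 * m) * \<rho> * \<rho>'"
  have R1: "R powr (2 * m) * R = R powr (2 * m + 1)" "\<rho> powr (2 * m) * \<rho> = \<rho> powr (2 * m + 1)"
    "R powr (2 * m) * R * R = R powr (2 * m + 2)"
    using powr_mult_base[of R "2 * m"] powr_mult_base[of \<rho> "2 * m"] powr_mult_base[of R "2 * m + 1"] R assms
    by (auto simp: mult_ac add_ac)
  have "\<rho> powr (2 * m) * \<rho> \<le> R powr (2 * m) * R"
    unfolding R1 using R assms by (intro powr_mono2) auto
  then have c: "0 \<le> c" "c \<le> R powr (2 * m) * R * R"
    unfolding c_def using R assms by (auto intro!: mult_mono)
  have "R powr (2 * m + 1) - \<rho> powr (2 * m + 1) \<le> (2 * m + 1) * R powr (2 * m) * (2 * r)"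
    using powr_diff_le[of R R \<rho> "2 * m + 1"] R assms by (simp add: R_def)
  then have "R * (R powr (2 * m + 1) - \<rho> powr (2 * m + 1)) \<le> R * ((2 * m + 1) * R powr (2 * m) * (2 * r))"
    using R by (intro mult_left_mono) auto
  moreover have "\<rho> powr (2 * m + 1) * (R - \<rho>') \<le> (R powr (2 * m) * R) * (3 * r)"
    unfolding R1 using R assms by (intro mult_mono powr_mono2) auto
  ultimately have 1: "R powr (2 * m + 2) - c \<le> (4 * m + 5) * r * (R powr (2 * m) * R)"
    unfolding c_def R1(2) R1(3)[symmetric] R1(1)[symmetric] by (simp add: algebra_simps)
  have "\<bar>\<Delta> - sin \<Delta>\<bar> \<le> \<bar>\<Delta>\<bar> ^ 3 / 6" using sin_minus_self_le[of \<Delta>] by (simp add: abs_minus_commute)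
  also have "\<dots> \<le> \<bar>\<Delta>\<bar>\<^sup>2"
  proof -
    have "\<bar>\<Delta>\<bar> ^ 3 = \<bar>\<Delta>\<bar>\<^sup>2 * \<bar>\<Delta>\<bar>" by (simp add: power2_eq_square power3_eq_cube)
    also have "\<dots> \<le> \<bar>\<Delta>\<bar>\<^sup>2 * 6" using assms by (intro mult_left_mono) auto
    finally show ?thesis by simp
  qed
  finally have 2: "\<bar>\<Delta> - sin \<Delta>\<bar> \<le> \<bar>\<Delta>\<bar>\<^sup>2" .
  have "R powr (2 * m + 2) * \<Delta> - c * sin \<Delta> = (R powr (2 * m + 2) - c) * \<Delta> + c * (\<Delta> - sin \<Delta>)"
    by (simp add: algebra_simps)
  also have "\<bar>\<dots>\<bar> \<le> (R powr (2 * m + 2) - c) * \<bar>\<Delta>\<bar> + c * \<bar>\<Delta> - sin \<Delta>\<bar>"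
    using c R1 by (intro order_trans[OF abs_triangle_ineq]) (auto simp: abs_mult)
  also have "\<dots> \<le> ((4 * m + 5) * r * (R powr (2 * m) * R)) * \<bar>\<Delta>\<bar> + (R powr (2 * m) * R * R) * \<bar>\<Delta>\<bar>\<^sup>2"
    using 1 2 c assms R by (intro add_mono mult_mono) auto
  also have "\<dots> = R powr (2 * m) * ((4 * m + 5) * r * (R * \<bar>\<Delta>\<bar>) + (R * \<bar>\<Delta>\<bar>)\<^sup>2)"
    by (simp add: algebra_simps power2_eq_square)
  also have "\<dots> \<le> R powr (2 * m) * ((4 * m + 5) * r * (16 * r) + (16 * r)\<^sup>2)"
    using assms R by (intro mult_left_mono add_mono power_mono mult_nonneg_nonneg) auto
  also have "\<dots> = (16 * (4 * m + 5) + 256) * r\<^sup>2 * R powr (2 * m)"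
    by (simp add: algebra_simps power2_eq_square)
  finally show ?thesis by (simp add: c_def)
qed

text \<open>The intermediate radius R = rho + 2r exceeds both end radii by at least r. A turn by k
  at R undone at rho' therefore changes t by at least |k| R^(2m+1) r, and a t-error of order r^2
  R^(2m) is corrected with R |k| of order r. The estimate is uniform in the position of the
  origin.\<close>

lemma cc_dist_le:
  fixes m A :: real
  assumes "m \<ge> 1" "A \<ge> 0"
  obtains U where "U > 0"
    and "\<And>p q r. \<lbrakk>0 \<le> r; norm (zc q - zc p) \<le> r;
          \<bar>tc q - tc p - omega m (zc p) \<bullet> (zc q - zc p)\<bar> \<le> A * r\<^sup>2 * (norm (zc p) + r) powr (2 * m)\<rbrakk>
        \<Longrightarrow> cc_dist m p q \<le> ennreal (U * r)"
proof
  \<comment> \<open>\<open>E\<close> bounds the t-error: \<open>A\<close> from the hypothesis, the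
    rest from \<open>loop_angle_le\<close>. The final constant is 4 (2 + (16 + E) + 3 + E), one
    summand for each piece of the polar curve.\<close>
  define E where "E = A + (16 * (4 * m + 5) + 256)"
  have "E \<ge> 0" using assms by (simp add: E_def)
  then show "84 + 8 * E > 0" by simp
  fix p q :: pt and r :: real
  assume "0 \<le> r" and dz: "norm (zc q - zc p) \<le> r"
    and dt: "\<bar>tc q - tc p - omega m (zc p) \<bullet> (zc q - zc p)\<bar> \<le> A * r\<^sup>2 * (norm (zc p) + r) powr (2 * m)"
  show "cc_dist m p q \<le> ennreal ((84 + 8 * E) * r)"
  proof (cases "r = 0")
    case True
    then have "p = q" using dz dt by (simp add: pt_eq_iff)
    then show ?thesis using assms by simp
  next
    case False
    with \<open>0 \<le> r\<close> have "r > 0" by simp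
    define \<rho> \<rho>' where "\<rho> = norm (zc p)" and "\<rho>' = norm (zc q)"
    have \<rho>: "\<rho> \<ge> 0" "\<rho>' \<ge> 0" "\<bar>\<rho>' - \<rho>\<bar> \<le> r"
      using dz norm_triangle_ineq3[of "zc q" "zc p"] by (auto simp: \<rho>_def \<rho>'_def)
    obtain a \<Delta> where zp: "zc p = (\<rho> * cos a, \<rho> * sin a)"
      and zq: "zc q = (\<rho>' * cos (a + \<Delta>), \<rho>' * sin (a + \<Delta>))" and "\<bar>\<Delta>\<bar> \<le> pi"
      using polar_pair[of "zc p" "zc q"] unfolding \<rho>_def \<rho>'_def by blast
    define R where "R = \<rho> + 2 * r"
    have R: "R > 0" "\<rho>' \<le> R" "R - \<rho>' \<ge> r" "R - \<rho>' \<le> 3 * r" using \<rho> \<open>r > 0\<close> by (auto simp: R_def)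
    have inner: "zc p \<bullet> zc q = \<rho> * \<rho>' * cos \<Delta>"
    proof -
      have "zc p \<bullet> zc q = \<rho> * \<rho>' * (cos a * cos (a + \<Delta>) + sin a * sin (a + \<Delta>))"
        by (simp add: zp zq algebra_simps)
      also have "cos a * cos (a + \<Delta>) + sin a * sin (a + \<Delta>) = cos \<Delta>"
        using cos_diff[of "a + \<Delta>" a] by (simp add: mult.commute)
      finally show ?thesis .
    qed
    have cross: "omega m (zc p) \<bullet> (zc q - zc p) = - (\<rho> powr (2 * m) * \<rho> * \<rho>' * sin \<Delta>)"
    proof -
      have "omega m (zc p) = \<rho> powr (2 * m) *\<^sub>R (\<rho> * sin a, - (\<rho> * cos a))"
        unfolding omega_def \<rho>_def[symmetric] by (simp add: zp)
      then have "omega m (zc p) \<bullet> (zc q - zc p)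
          = - (\<rho> powr (2 * m) * \<rho> * \<rho>' * (sin (a + \<Delta>) * cos a - cos (a + \<Delta>) * sin a))"
        by (simp add: zp zq algebra_simps)
      also have "sin (a + \<Delta>) * cos a - cos (a + \<Delta>) * sin a = sin \<Delta>"
        using sin_diff[of "a + \<Delta>" a] by simp
      finally show ?thesis .
    qed
    have "(norm (zc q - zc p))\<^sup>2 \<le> r\<^sup>2" using dz by (intro power_mono) auto
    then have "\<rho>\<^sup>2 + \<rho>'\<^sup>2 - 2 * \<rho> * \<rho>' * cos \<Delta> \<le> r\<^sup>2"
      using inner by (simp add: power2_norm_eq_inner inner_diff_left inner_diff_right inner_commute mult_ac \<rho>_def \<rho>'_def)
    then have R\<Delta>: "R * \<bar>\<Delta>\<bar> \<le> 16 * r"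
      unfolding R_def using \<rho> \<open>r > 0\<close> \<open>\<bar>\<Delta>\<bar> \<le> pi\<close> by (intro angle_le) auto
    define W where "W = R powr (2 * m + 2)"
    define W' where "W' = \<rho>' powr (2 * m + 2)"
    define T where "T = tc q - tc p"
    have "\<bar>W * \<Delta> - \<rho> powr (2 * m) * \<rho> * \<rho>' * sin \<Delta>\<bar>
        \<le> (16 * (4 * m + 5) + 256) * r\<^sup>2 * R powr (2 * m)"
      unfolding W_def R_def using \<rho> assms \<open>r > 0\<close> \<open>\<bar>\<Delta>\<bar> \<le> pi\<close> pi_less_4 R\<Delta>
      by (intro loop_angle_le) (auto simp: R_def)
    moreover have "\<bar>T + \<rho> powr (2 * m) * \<rho> * \<rho>' * sin \<Delta>\<bar> \<le> A * r\<^sup>2 * R powr (2 * m)"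
    proof -
      have "(norm (zc p) + r) powr (2 * m) \<le> R powr (2 * m)"
        unfolding R_def \<rho>_def using \<open>r > 0\<close> assms by (intro powr_mono2) auto
      then have "A * r\<^sup>2 * (norm (zc p) + r) powr (2 * m) \<le> A * r\<^sup>2 * R powr (2 * m)"
        using assms by (intro mult_left_mono) auto
      then show ?thesis using dt by (simp add: T_def cross)
    qed
    moreover have "T + W * \<Delta> = (T + \<rho> powr (2 * m) * \<rho> * \<rho>' * sin \<Delta>)
        + (W * \<Delta> - \<rho> powr (2 * m) * \<rho> * \<rho>' * sin \<Delta>)" by simp
    ultimately have TW: "\<bar>T + W * \<Delta>\<bar> \<le> E * r\<^sup>2 * R powr (2 * m)"
      unfolding E_def distrib_right by linarith
    have WR: "W = R powr (2 * m + 1) * R" "W' = \<rho>' powr (2 * m + 1) * \<rho>'"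
      "R powr (2 * m + 1) = R powr (2 * m) * R"
      using powr_mult_base[of R "2 * m + 1"] powr_mult_base[of \<rho>' "2 * m + 1"] powr_mult_base[of R "2 * m"] R \<rho>
      by (auto simp: W_def W'_def mult_ac add_ac)
    have "R powr (2 * m + 1) * r \<le> R powr (2 * m + 1) * (R - \<rho>')"
      using R by (intro mult_left_mono) auto
    also have "\<dots> \<le> W - W'"
    proof -
      have "\<rho>' powr (2 * m + 1) * \<rho>' \<le> R powr (2 * m + 1) * \<rho>'"
        using R \<rho> assms by (intro mult_right_mono powr_mono2) auto
      then show ?thesis by (simp add: WR(1,2) algebra_simps)
    qed
    finally have WW: "R powr (2 * m) * R * r \<le> W - W'" by (simp add: WR(3))
    moreover have "R powr (2 * m) * R * r > 0" using R \<open>r > 0\<close> by simp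
    ultimately have "W - W' > 0" by linarith
    \<comment> \<open>turning by \<open>\<Delta> + k\<close> at radius \<open>R\<close> and back by \<open>k\<close> at radius \<open>\<rho>'\<close> reaches \<open>q\<close> exactly\<close>
    define k where "k = - ((T + W * \<Delta>) / (W - W'))"
    have "R * \<bar>k\<bar> \<le> E * r"
    proof -
      have "\<bar>T + W * \<Delta>\<bar> * R \<le> (E * r\<^sup>2 * R powr (2 * m)) * R"
        using TW R by (intro mult_right_mono) auto
      also have "\<dots> = (E * r) * (R powr (2 * m) * R * r)" by (simp add: power2_eq_square)
      also have "\<dots> \<le> (E * r) * (W - W')"
        using WW \<open>E \<ge> 0\<close> \<open>r > 0\<close> by (intro mult_left_mono) auto
      finally have "\<bar>T + W * \<Delta>\<bar> * R / (W - W') \<le> E * r"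
        using \<open>W - W' > 0\<close> by (simp add: pos_divide_le_eq)
      then show ?thesis using \<open>W - W' > 0\<close> by (simp add: k_def mult.commute)
    qed
    have p: "p = (\<rho> * cos a, \<rho> * sin a, tc p)"
      using zp by (simp add: pt_eq_iff zc_def tc_def)
    have "k * (W - W') = - (T + W * \<Delta>)" using \<open>W - W' > 0\<close> by (simp add: k_def)
    then have "tc q = tc p - W * (\<Delta> + k) - W' * (- k)"
      unfolding T_def by (simp add: algebra_simps)
    then have q: "q = (\<rho>' * cos (a + (\<Delta> + k) + (- k)), \<rho>' * sin (a + (\<Delta> + k) + (- k)), tc p - W * (\<Delta> + k) - W' * (- k))"
      using zq by (simp add: pt_eq_iff zc_def tc_def)
    have "cc_dist m p q \<le> ennreal (4 * (\<bar>R - \<rho>\<bar> + R * \<bar>\<Delta> + k\<bar> + \<bar>\<rho>' - R\<bar> + \<rho>' * \<bar>- k\<bar>))"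
      by (subst p, subst q, unfold W_def W'_def, rule cc_dist_polar_le) (use \<rho> R assms in auto)
    also have "\<dots> \<le> ennreal ((84 + 8 * E) * r)"
    proof (rule ennreal_leI)
      have "R * \<bar>\<Delta> + k\<bar> \<le> R * \<bar>\<Delta>\<bar> + R * \<bar>k\<bar>"
        unfolding distrib_left[symmetric] using R by (intro mult_left_mono abs_triangle_ineq) auto
      moreover have "\<rho>' * \<bar>- k\<bar> \<le> R * \<bar>k\<bar>" using R by (simp add: mult_right_mono)
      moreover have "\<bar>R - \<rho>\<bar> = 2 * r" using \<open>r > 0\<close> by (simp add: R_def)
      moreover have "\<bar>\<rho>' - R\<bar> \<le> 3 * r" using R by simp
      ultimately show "4 * (\<bar>R - \<rho>\<bar> + R * \<bar>\<Delta> + k\<bar> + \<bar>\<rho>' - R\<bar> + \<rho>' * \<bar>- k\<bar>) \<le> (84 + 8 * E) * r"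
        using \<open>R * \<bar>k\<bar> \<le> E * r\<close> R\<Delta> by (simp add: distrib_right)
    qed
    finally show ?thesis .
  qed
qed

section \<open>Functions with controlled second derivatives\<close>

definition grad :: "(real \<times> real \<Rightarrow> real) \<Rightarrow> real \<times> real \<Rightarrow> real \<times> real" where
  "grad f z = (pdx f z, pdy f z)"

lemma pd_has_real_derivative:
  assumes "smooth2 f"
  shows "((\<lambda>u. pd ds f (u, y)) has_real_derivative pd (True # ds) f (x, y)) (at x)"
    and "((\<lambda>v. pd ds f (x, v)) has_real_derivative pd (False # ds) f (x, y)) (at y)"
  using assms by (simp_all add: smooth2_def pdx_def pdy_def DERIV_deriv_iff_real_differentiable)

lemma abs_pd_le_Dk_norm: "\<bar>pd ds f z\<bar> \<le> Dk_norm (length ds) f z"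
proof -
  have "finite {ds :: bool list. length ds = k}" for k
    using finite_lists_length_eq[of "UNIV :: bool set" k] by simp
  then have "finite {\<bar>pd es f z\<bar> | es. length es = length ds}"
    by (simp add: setcompr_eq_image)
  then show ?thesis unfolding Dk_norm_def by (intro Max_ge) auto
qed

lemma mvt_abs:
  fixes f :: "real \<Rightarrow> real"
  assumes "\<And>x. (f has_real_derivative f' x) (at x)"
  obtains c where "\<bar>c - a\<bar> \<le> \<bar>b - a\<bar>" "f b - f a = f' c * (b - a)"
proof (cases a b rule: linorder_cases)
  case less
  then obtain c where "a < c" "c < b" "f b - f a = (b - a) * f' c"
    using MVT2[of a b f f'] assms by blast
  then show ?thesis by (intro that[of c]) auto
next
  case equal
  then show ?thesis by (intro that[of a]) auto
next
  case greater
  then obtain c where "b < c" "c < a" "f a - f b = (a - b) * f' c"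
    using MVT2[of b a f f'] assms by blast
  then show ?thesis by (intro that[of c]) (auto simp: algebra_simps)
qed

lemma norm_prod_mono:
  fixes x y x' y' :: real
  assumes "\<bar>x\<bar> \<le> \<bar>x'\<bar>" "\<bar>y\<bar> \<le> \<bar>y'\<bar>"
  shows "norm (x, y) \<le> norm (x', y')"
  using assms by (auto simp: norm_prod_def abs_le_square_iff intro: add_mono)

text \<open>The mean value theorem along a staircase, first in x and then in y. Both intermediate
  points are no farther from z than w is, so bounds on a disc apply to them.\<close>

lemma mvt_two_step:
  fixes f :: "real \<times> real \<Rightarrow> real"
  assumes "\<And>x y. ((\<lambda>u. f (u, y)) has_real_derivative fx (x, y)) (at x)"
    and "\<And>x y. ((\<lambda>v. f (x, v)) has_real_derivative fy (x, y)) (at y)"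
  obtains c d where "norm (c - z) \<le> norm (w - z)" "norm (d - z) \<le> norm (w - z)"
    "f w - f z = fx c * (fst w - fst z) + fy d * (snd w - snd z)"
proof -
  obtain \<xi> where \<xi>: "\<bar>\<xi> - fst z\<bar> \<le> \<bar>fst w - fst z\<bar>"
    "f (fst w, snd z) - f (fst z, snd z) = fx (\<xi>, snd z) * (fst w - fst z)"
    using mvt_abs[OF assms(1)] by metis
  obtain \<eta> where \<eta>: "\<bar>\<eta> - snd z\<bar> \<le> \<bar>snd w - snd z\<bar>"
    "f (fst w, snd w) - f (fst w, snd z) = fy (fst w, \<eta>) * (snd w - snd z)"
    using mvt_abs[OF assms(2)] by metis
  have wz: "w - z = (fst w - fst z, snd w - snd z)" by (simp add: prod_eq_iff)
  show ?thesis
  proof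
    have "(\<xi>, snd z) - z = (\<xi> - fst z, 0)" by (simp add: prod_eq_iff)
    then show "norm ((\<xi>, snd z) - z) \<le> norm (w - z)"
      unfolding wz using \<xi> by (metis norm_prod_mono abs_0 abs_ge_zero)
    have "(fst w, \<eta>) - z = (fst w - fst z, \<eta> - snd z)" by (simp add: prod_eq_iff)
    then show "norm ((fst w, \<eta>) - z) \<le> norm (w - z)"
      unfolding wz using \<eta> by (metis norm_prod_mono order_refl)
    show "f w - f z = fx (\<xi>, snd z) * (fst w - fst z) + fy (fst w, \<eta>) * (snd w - snd z)"
      using \<xi> \<eta> by simp
  qed
qed

lemma abs_fst_snd_le_norm: "\<bar>fst z\<bar> \<le> norm z" "\<bar>snd z\<bar> \<le> norm z" for z :: "real \<times> real"
  using norm_fst_le[of "fst z" "snd z"] norm_snd_le[of "snd z" "fst z"] by simp_all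

context
  fixes m C :: real and \<phi> :: "real \<times> real \<Rightarrow> real"
  assumes m: "m \<ge> 1" and C: "C > 0" and smooth: "smooth2 \<phi>"
    and D2: "\<And>z. Dk_norm 2 \<phi> z \<le> C * norm z powr (2 * m)"
begin

lemma pd_diff_le:
  assumes "norm (w - z) \<le> r"
  shows "\<bar>pd [d] \<phi> w - pd [d] \<phi> z\<bar> \<le> 2 * C * r * (norm z + r) powr (2 * m)"
proof -
  define M where "M = C * (norm z + r) powr (2 * m)"
  have M: "\<bar>pd [e, d] \<phi> c\<bar> \<le> M" if "norm (c - z) \<le> norm (w - z)" for e c
  proof -
    have "\<bar>pd [e, d] \<phi> c\<bar> \<le> C * norm c powr (2 * m)"
      using abs_pd_le_Dk_norm[of "[e, d]" \<phi> c] D2[of c] by (simp add: eval_nat_numeral)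
    also have "norm c \<le> norm z + r" using that assms norm_triangle_sub[of c z] by linarith
    then have "C * norm c powr (2 * m) \<le> M"
      unfolding M_def using m C by (intro mult_left_mono powr_mono2) auto
    finally show ?thesis .
  qed
  obtain c e where ce: "norm (c - z) \<le> norm (w - z)" "norm (e - z) \<le> norm (w - z)"
    "pd [d] \<phi> w - pd [d] \<phi> z = pd [True, d] \<phi> c * (fst w - fst z) + pd [False, d] \<phi> e * (snd w - snd z)"
    using mvt_two_step[OF pd_has_real_derivative[OF smooth, of "[d]"]] by metis
  have "\<bar>fst w - fst z\<bar> \<le> r" "\<bar>snd w - snd z\<bar> \<le> r"
    using abs_fst_snd_le_norm[of "w - z"] assms by auto
  then have "\<bar>pd [True, d] \<phi> c\<bar> * \<bar>fst w - fst z\<bar> \<le> M * r" "\<bar>pd [False, d] \<phi> e\<bar> * \<bar>snd w - snd z\<bar> \<le> M * r"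
    using M ce(1,2) by (meson mult_mono abs_ge_zero order_trans)+
  then have "\<bar>pd [d] \<phi> w - pd [d] \<phi> z\<bar> \<le> M * r + M * r"
    unfolding ce(3) by (intro order_trans[OF abs_triangle_ineq] add_mono) (simp_all add: abs_mult)
  then show ?thesis by (simp add: M_def mult_ac)
qed

lemma grad_diff_le:
  assumes "norm (w - z) \<le> r"
  shows "norm (grad \<phi> w - grad \<phi> z) \<le> 4 * C * r * (norm z + r) powr (2 * m)"
proof -
  have "norm (grad \<phi> w - grad \<phi> z) \<le> \<bar>pdx \<phi> w - pdx \<phi> z\<bar> + \<bar>pdy \<phi> w - pdy \<phi> z\<bar>"
    unfolding grad_def using norm_Pair_le[of "pdx \<phi> w - pdx \<phi> z" "pdy \<phi> w - pdy \<phi> z"] by simp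
  then show ?thesis
    using pd_diff_le[OF assms, of True] pd_diff_le[OF assms, of False] by simp
qed

text \<open>First-order mean values suffice: replacing the partial derivatives at the intermediate
  points by those at z costs \<open>pd_diff_le\<close> twice, which makes 4C.\<close>

lemma taylor_grad_le:
  assumes "norm (w - z) \<le> r"
  shows "\<bar>\<phi> w - \<phi> z - grad \<phi> z \<bullet> (w - z)\<bar> \<le> 4 * C * r\<^sup>2 * (norm z + r) powr (2 * m)"
proof -
  define M where "M = 2 * C * r * (norm z + r) powr (2 * m)"
  obtain c d where cd: "norm (c - z) \<le> norm (w - z)" "norm (d - z) \<le> norm (w - z)"
    "\<phi> w - \<phi> z = pdx \<phi> c * (fst w - fst z) + pdy \<phi> d * (snd w - snd z)"
    using mvt_two_step[OF pd_has_real_derivative[OF smooth, of "[]", simplified]] by metis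
  have M: "\<bar>pdx \<phi> c - pdx \<phi> z\<bar> \<le> M" "\<bar>pdy \<phi> d - pdy \<phi> z\<bar> \<le> M"
    using pd_diff_le[of c z r True] pd_diff_le[of d z r False] cd(1,2) assms by (auto simp: M_def)
  have "\<bar>fst w - fst z\<bar> \<le> r" "\<bar>snd w - snd z\<bar> \<le> r"
    using abs_fst_snd_le_norm[of "w - z"] assms by auto
  then have "\<bar>pdx \<phi> c - pdx \<phi> z\<bar> * \<bar>fst w - fst z\<bar> \<le> M * r" "\<bar>pdy \<phi> d - pdy \<phi> z\<bar> * \<bar>snd w - snd z\<bar> \<le> M * r"
    using M by (meson mult_mono abs_ge_zero order_trans)+
  moreover have "\<phi> w - \<phi> z - grad \<phi> z \<bullet> (w - z)
      = (pdx \<phi> c - pdx \<phi> z) * (fst w - fst z) + (pdy \<phi> d - pdy \<phi> z) * (snd w - snd z)"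
    unfolding cd(3) by (cases w; cases z) (simp add: grad_def algebra_simps)
  moreover have "\<bar>(pdx \<phi> c - pdx \<phi> z) * (fst w - fst z) + (pdy \<phi> d - pdy \<phi> z) * (snd w - snd z)\<bar>
      \<le> \<bar>pdx \<phi> c - pdx \<phi> z\<bar> * \<bar>fst w - fst z\<bar> + \<bar>pdy \<phi> d - pdy \<phi> z\<bar> * \<bar>snd w - snd z\<bar>"
    unfolding abs_mult[symmetric] by (rule abs_triangle_ineq)
  ultimately have "\<bar>\<phi> w - \<phi> z - grad \<phi> z \<bullet> (w - z)\<bar> \<le> M * r + M * r" by linarith
  then show ?thesis by (simp add: M_def power2_eq_square mult_ac)
qed

end

section \<open>Epigraphs\<close>

locale controlled_graph =
  fixes m C :: real and \<phi> :: "real \<times> real \<Rightarrow> real"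
  assumes m: "m \<ge> 1" and C: "C > 0" and smooth: "smooth2 \<phi>"
    and D2: "\<And>z. Dk_norm 2 \<phi> z \<le> C * norm z powr (2 * m)"
begin

definition hgrad :: "real \<times> real \<Rightarrow> real \<times> real" where "hgrad z = omega m z - grad \<phi> z"
definition ht :: "pt \<Rightarrow> real" where "ht p = tc p - \<phi> (zc p)"
text \<open>Inverse of the coordinates \<open>(zc p, ht p)\<close>, in which the connecting curve is
  built.\<close>

definition lift :: "(real \<times> real) \<times> real \<Rightarrow> pt" where
  "lift w = (fst (fst w), snd (fst w), snd w + \<phi> (fst w))"
definition scale :: "real \<times> real \<Rightarrow> real \<Rightarrow> real" where
  "scale z r = r\<^sup>2 * (norm z + r) powr (2 * m)"
text \<open>The sum of the constants of \<open>omega_diff_le\<close> and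
  \<open>grad_diff_le\<close>. The Taylor estimate has the same 4C, so \<open>L\<close> also serves
  as the constant in \<open>near_if_cc_dist_less\<close>.\<close>

definition L :: real where "L = 2 * m + 1 + 4 * C"
text \<open>Up to constants, the points within distance \<open>r\<close> of \<open>p\<close>.\<close>
definition near :: "pt \<Rightarrow> real \<Rightarrow> real \<Rightarrow> pt \<Rightarrow> bool" where
  "near p r A a \<longleftrightarrow> norm (zc a - zc p) \<le> r
     \<and> \<bar>ht a - ht p - hgrad (zc p) \<bullet> (zc a - zc p)\<bar> \<le> A * scale (zc p) r"
text \<open>The order of the oscillation of the height on a ball of radius \<open>r\<close> centred over \<open>z\<close>.\<close>
definition gain :: "real \<times> real \<Rightarrow> real \<Rightarrow> real" where
  "gain z r = norm (hgrad z) * r + scale z r"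

section \<open>Coordinates and comparison of scales\<close>

lemma lift_simps [simp]: "zc (lift w) = fst w" "ht (lift w) = snd w"
  by (simp_all add: lift_def zc_def ht_def tc_def)

lemma lift_ht [simp]: "lift (zc p, ht p) = p"
  by (simp add: lift_def zc_def ht_def tc_def)

lemma mem_epi_iff: "p \<in> epi \<phi> \<longleftrightarrow> ht p > 0"
  by (cases p) (auto simp: epi_def ht_def zc_def tc_def)

lemma L_pos: "L > 0" using m C by (simp add: L_def)

lemma scale_nonneg: "scale z r \<ge> 0" by (simp add: scale_def)

lemma scale_0 [simp]: "scale z 0 = 0" by (simp add: scale_def)

lemma scale_pos: "r > 0 \<Longrightarrow> scale z r > 0"
  using add_nonneg_pos[OF norm_ge_zero[of z], of r] by (simp add: scale_def)

lemma gain_nonneg: "r \<ge> 0 \<Longrightarrow> gain z r \<ge> 0"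
  by (simp add: gain_def scale_nonneg)

text \<open>Multiplied out by the squared radii, so that no quotient s/r appears and r = 0 is
  allowed.\<close>

lemma scale_le_scale:
  assumes "0 \<le> r" "0 \<le> s" "0 \<le> k" "norm w + s \<le> k * (norm z + r)"
  shows "scale w s * r\<^sup>2 \<le> s\<^sup>2 * k powr (2 * m) * scale z r"
proof -
  have "(norm w + s) powr (2 * m) \<le> (k * (norm z + r)) powr (2 * m)"
    using assms m by (intro powr_mono2) auto
  also have "\<dots> = k powr (2 * m) * (norm z + r) powr (2 * m)"
    using assms by (intro powr_mult)
  finally have "s\<^sup>2 * r\<^sup>2 * (norm w + s) powr (2 * m) \<le> s\<^sup>2 * r\<^sup>2 * (k powr (2 * m) * (norm z + r) powr (2 * m))"
    by (intro mult_left_mono) auto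
  then show ?thesis by (simp add: scale_def mult_ac)
qed

lemma scale_base_le:
  assumes "0 \<le> r" "0 \<le> k" "norm (w - z) \<le> k * r"
  shows "scale w r \<le> (1 + k) powr (2 * m) * scale z r"
proof (cases "r = 0")
  case False
  have "norm w \<le> norm z + k * r" using norm_triangle_sub[of w z] assms by linarith
  moreover have "0 \<le> k * norm z" using assms by simp
  ultimately have "norm w + r \<le> (1 + k) * (norm z + r)"
    by (simp add: algebra_simps)
  with assms have "scale w r * r\<^sup>2 \<le> r\<^sup>2 * (1 + k) powr (2 * m) * scale z r"
    by (intro scale_le_scale) auto
  then show ?thesis using False by (simp add: mult_ac)
qed simp

lemma scale_contract:
  assumes "0 \<le> r" "0 \<le> c" "c \<le> 1"
  shows "scale z (c * r) \<le> c\<^sup>2 * scale z r"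
proof -
  have "(norm z + c * r) powr (2 * m) \<le> (norm z + r) powr (2 * m)"
    using assms m by (intro powr_mono2 add_left_mono mult_left_le_one_le) auto
  then have "(c * r)\<^sup>2 * (norm z + c * r) powr (2 * m) \<le> (c * r)\<^sup>2 * (norm z + r) powr (2 * m)"
    by (intro mult_left_mono) auto
  then show ?thesis by (simp add: scale_def power_mult_distrib mult_ac)
qed

lemma scale_mono:
  assumes "0 \<le> r" "r \<le> s"
  shows "scale z r \<le> scale z s"
  unfolding scale_def using assms m by (intro mult_mono power_mono powr_mono2) auto

text \<open>Doubling the radius absorbs a change of base point with a factor 4 to spare, and this
  factor pays for the error terms when neighbourhoods are recentred.\<close>

lemma scale_double_le:
  assumes "0 \<le> r" "norm (w - z) \<le> r"
  shows "4 * scale w r \<le> scale z (2 * r)"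
proof -
  have "norm w + r \<le> norm z + 2 * r" using norm_triangle_sub[of w z] assms by linarith
  then have "(norm w + r) powr (2 * m) \<le> (norm z + 2 * r) powr (2 * m)"
    using assms m by (intro powr_mono2) auto
  then have "(2 * r)\<^sup>2 * (norm w + r) powr (2 * m) \<le> (2 * r)\<^sup>2 * (norm z + 2 * r) powr (2 * m)"
    by (intro mult_left_mono) auto
  then show ?thesis by (simp add: scale_def power_mult_distrib)
qed

section \<open>First-order control of the height and of the distance\<close>

lemma hgrad_diff_le:
  assumes "0 \<le> r" "norm (w - z) \<le> r"
  shows "norm (hgrad w - hgrad z) * r \<le> L * scale z r"
proof -
  have "hgrad w - hgrad z = (omega m w - omega m z) - (grad \<phi> w - grad \<phi> z)"
    by (simp add: hgrad_def)
  also have "norm \<dots> \<le> norm (omega m w - omega m z) + norm (grad \<phi> w - grad \<phi> z)"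
    by (rule norm_triangle_ineq4)
  also have "\<dots> \<le> L * r * (norm z + r) powr (2 * m)"
    using omega_diff_le[OF m assms(2)] grad_diff_le[OF m C smooth D2 assms(2)]
    by (simp add: L_def algebra_simps)
  finally have "norm (hgrad w - hgrad z) * r \<le> L * r * (norm z + r) powr (2 * m) * r"
    using assms by (intro mult_right_mono) auto
  then show ?thesis by (simp add: scale_def power2_eq_square mult_ac)
qed

text \<open>The bridge between t and the height: one first-order error is controlled by the
  distance, the other by Taylor's formula for phi.\<close>

lemma ht_diff:
  "ht q - ht p - hgrad (zc p) \<bullet> (zc q - zc p)
   = (tc q - tc p - omega m (zc p) \<bullet> (zc q - zc p)) - (\<phi> (zc q) - \<phi> (zc p) - grad \<phi> (zc p) \<bullet> (zc q - zc p))"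
  by (simp add: ht_def hgrad_def inner_diff_left)

lemma near_if_cc_dist_less:
  assumes "cc_dist m p q < ennreal r"
  shows "near p r L q"
proof -
  note d = cc_dist_lessD[OF m assms]
  have "\<bar>ht q - ht p - hgrad (zc p) \<bullet> (zc q - zc p)\<bar>
      \<le> (2 * m + 1) * r\<^sup>2 * (norm (zc p) + r) powr (2 * m) + 4 * C * r\<^sup>2 * (norm (zc p) + r) powr (2 * m)"
    unfolding ht_diff
    using d(2) taylor_grad_le[OF m C smooth D2 d(1)] by linarith
  also have "\<dots> = L * scale (zc p) r" by (simp add: L_def scale_def algebra_simps)
  finally show ?thesis using d(1) by (simp add: near_def)
qed

lemma cc_dist_near:
  assumes "A \<ge> 0"
  obtains U where "U > 0" "\<And>p q r. 0 \<le> r \<Longrightarrow> near p r A q \<Longrightarrow> cc_dist m p q \<le> ennreal (U * r)"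
proof -
  obtain U where U: "U > 0" "\<And>p q r. \<lbrakk>0 \<le> r; norm (zc q - zc p) \<le> r;
          \<bar>tc q - tc p - omega m (zc p) \<bullet> (zc q - zc p)\<bar> \<le> (A + 4 * C) * r\<^sup>2 * (norm (zc p) + r) powr (2 * m)\<rbrakk>
        \<Longrightarrow> cc_dist m p q \<le> ennreal (U * r)"
    using cc_dist_le[OF m, of "A + 4 * C"] assms C by auto
  show ?thesis
  proof (rule that[OF U(1)], rule U(2))
    fix p q r assume "0 \<le> r" and near: "near p r A q"
    show "0 \<le> r" by fact
    show dz: "norm (zc q - zc p) \<le> r" using near by (simp add: near_def)
    have "\<bar>ht q - ht p - hgrad (zc p) \<bullet> (zc q - zc p)\<bar> \<le> A * r\<^sup>2 * (norm (zc p) + r) powr (2 * m)"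
      using near by (simp add: near_def scale_def mult_ac)
    then show "\<bar>tc q - tc p - omega m (zc p) \<bullet> (zc q - zc p)\<bar> \<le> (A + 4 * C) * r\<^sup>2 * (norm (zc p) + r) powr (2 * m)"
      unfolding ht_diff distrib_right using taylor_grad_le[OF m C smooth D2 dz] by linarith
  qed
qed

lemma near_mono:
  assumes "near p r A a" "0 \<le> r" "r \<le> s" "A \<le> B" "0 \<le> A"
  shows "near p s B a"
proof -
  have "A * scale (zc p) r \<le> B * scale (zc p) s"
    using assms scale_mono[of r s] by (intro mult_mono) (auto simp: scale_nonneg)
  then show ?thesis using assms by (auto simp: near_def)
qed

text \<open>Diameters need the distance between two arbitrary points, while \<open>near\<close> is
  centred at p. Recentring at a costs a factor 2 in the radius and, for the change of
  \<open>hgrad\<close>, an additional \<open>L\<close> in the constant.\<close>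

lemma near_pair:
  assumes "0 \<le> r" "0 \<le> A" "near p r A a" "near p r A b"
  shows "near a (2 * r) (A + L) b"
proof -
  have d: "norm (zc a - zc p) \<le> r" "norm (zc b - zc p) \<le> r" using assms by (auto simp: near_def)
  have ab: "norm (zc b - zc a) \<le> 2 * r"
    using norm_triangle_ineq4[of "zc b - zc p" "zc a - zc p"] d by simp
  have 1: "ht b - ht a - hgrad (zc a) \<bullet> (zc b - zc a)
     = (ht b - ht p - hgrad (zc p) \<bullet> (zc b - zc p)) - (ht a - ht p - hgrad (zc p) \<bullet> (zc a - zc p))
       - (hgrad (zc a) - hgrad (zc p)) \<bullet> (zc b - zc a)"
    by (simp add: inner_diff_left inner_diff_right)
  have "\<bar>(hgrad (zc a) - hgrad (zc p)) \<bullet> (zc b - zc a)\<bar> \<le> norm (hgrad (zc a) - hgrad (zc p)) * (2 * r)"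
    using ab by (intro order_trans[OF Cauchy_Schwarz_ineq2] mult_left_mono) auto
  also have "\<dots> \<le> 2 * (L * scale (zc p) r)" using hgrad_diff_le[OF \<open>0 \<le> r\<close> d(1)] by simp
  finally have "\<bar>ht b - ht a - hgrad (zc a) \<bullet> (zc b - zc a)\<bar> \<le> 2 * (A * scale (zc p) r) + 2 * (L * scale (zc p) r)"
    unfolding 1 using assms(3,4) unfolding near_def by linarith
  also have "\<dots> = (A + L) / 2 * (4 * scale (zc p) r)" by (simp add: algebra_simps)
  also have "\<dots> \<le> (A + L) / 2 * scale (zc a) (2 * r)"
    using d(1) assms L_pos by (intro mult_left_mono scale_double_le) (auto simp: norm_minus_commute)
  also have "\<dots> \<le> (A + L) * scale (zc a) (2 * r)"
    using assms L_pos scale_nonneg by (intro mult_right_mono) auto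
  finally show ?thesis using ab by (simp add: near_def)
qed

lemma cc_diam_near:
  assumes "A \<ge> 0"
  obtains U where "U > 0"
    "\<And>p S r. 0 \<le> r \<Longrightarrow> (\<And>a. a \<in> S \<Longrightarrow> near p r A a) \<Longrightarrow> cc_diam m S \<le> ennreal (U * r)"
proof -
  obtain U where U: "U > 0" "\<And>p q r. 0 \<le> r \<Longrightarrow> near p r (A + L) q \<Longrightarrow> cc_dist m p q \<le> ennreal (U * r)"
    using cc_dist_near[of "A + L"] assms L_pos by (metis add_nonneg_nonneg less_imp_le)
  show ?thesis
  proof
    show "2 * U > 0" using U by simp
    fix p S r assume "0 \<le> r" and S: "\<And>a. a \<in> S \<Longrightarrow> near p r A a"
    have "cc_dist m a b \<le> ennreal (2 * U * r)" if "a \<in> S" "b \<in> S" for a b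
      using U(2)[OF _ near_pair[OF \<open>0 \<le> r\<close> assms S[OF that(1)] S[OF that(2)]]] \<open>0 \<le> r\<close> by (simp add: mult_ac)
    then show "cc_diam m S \<le> ennreal (2 * U * r)"
      unfolding cc_diam_def by (intro SUP_least) auto
  qed
qed

text \<open>On a ball of radius eps r the height varies by at most eps E gain, so a small eps loses
  only half of the available height. The gain is taken at z and not at the centre a, because along
  the curve it is known over p or q only.\<close>

lemma cc_ball_subset_epi:
  assumes "c > 0"
  obtains \<epsilon> where "\<epsilon> > 0" "\<And>z a r. \<lbrakk>0 \<le> r; norm (zc a - z) \<le> 2 * r; c * gain z r \<le> ht a\<rbrakk>
       \<Longrightarrow> cc_ball m a (ennreal (\<epsilon> * r)) \<subseteq> epi \<phi>"
proof
  \<comment> \<open>The 1 is for |H| r at z, the second term for the change of H between z and a at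
    distance 2r, and the third for the scale at a; its base 3 is 1 + 2 from
    \<open>scale_base_le\<close>.\<close>
  define E where "E = 1 + 2 * L * 2 powr (2 * m) + L * 3 powr (2 * m)"
  have "E > 0" using L_pos by (simp add: E_def add_pos_nonneg)
  define \<epsilon> where "\<epsilon> = min 1 (c / (2 * E))"
  show \<epsilon>: "\<epsilon> > 0" using assms \<open>E > 0\<close> by (simp add: \<epsilon>_def)
  have "\<epsilon> \<le> 1" by (simp add: \<epsilon>_def)
  have "\<epsilon> \<le> c / (2 * E)" by (simp add: \<epsilon>_def)
  then have \<epsilon>E: "\<epsilon> * E \<le> c / 2" using \<open>E > 0\<close> by (simp add: field_simps)
  fix z a r assume "0 \<le> r" and za: "norm (zc a - z) \<le> 2 * r" and ha: "c * gain z r \<le> ht a"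
  show "cc_ball m a (ennreal (\<epsilon> * r)) \<subseteq> epi \<phi>"
  proof
    fix b assume "b \<in> cc_ball m a (ennreal (\<epsilon> * r))"
    then have lt: "cc_dist m a b < ennreal (\<epsilon> * r)" by (simp add: cc_ball_def)
    \<comment> \<open>A ball of radius 0 is empty, since the inequality defining
      \<open>cc_ball\<close> is strict.\<close>
    then have "r > 0" using \<open>0 \<le> r\<close> by (cases "r = 0") auto
    have near: "near a (\<epsilon> * r) L b" using lt by (rule near_if_cc_dist_less)
    have "norm (hgrad (zc a) - hgrad z) * (2 * r) \<le> L * scale z (2 * r)"
      using za \<open>0 \<le> r\<close> by (intro hgrad_diff_le) auto
    also have "scale z (2 * r) \<le> 4 * 2 powr (2 * m) * scale z r"
    proof -
      have "scale z (2 * r) * r\<^sup>2 \<le> (2 * r)\<^sup>2 * 2 powr (2 * m) * scale z r"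
        using \<open>r > 0\<close> by (intro scale_le_scale) auto
      then show ?thesis using \<open>r > 0\<close> by (simp add: power_mult_distrib mult_ac)
    qed
    finally have 1: "norm (hgrad (zc a) - hgrad z) * r \<le> 2 * L * 2 powr (2 * m) * scale z r"
      using L_pos by (simp add: mult_ac)
    have "norm (hgrad (zc a)) * r \<le> norm (hgrad z) * r + norm (hgrad (zc a) - hgrad z) * r"
      unfolding distrib_right[symmetric] using \<open>r > 0\<close> norm_triangle_sub by (intro mult_right_mono) auto
    then have 2: "norm (hgrad (zc a)) * r \<le> norm (hgrad z) * r + 2 * L * 2 powr (2 * m) * scale z r"
      using 1 by linarith
    have "scale (zc a) (\<epsilon> * r) \<le> \<epsilon>\<^sup>2 * scale (zc a) r"
      using \<open>\<epsilon> > 0\<close> \<open>\<epsilon> \<le> 1\<close> \<open>r > 0\<close> by (intro scale_contract) auto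
    also have "\<dots> \<le> \<epsilon> * (3 powr (2 * m) * scale z r)"
      using \<open>\<epsilon> > 0\<close> \<open>\<epsilon> \<le> 1\<close> \<open>r > 0\<close> za scale_base_le[of r 2 "zc a" z] scale_nonneg
      by (intro mult_mono) (auto simp: power2_eq_square mult_left_le_one_le)
    finally have 3: "L * scale (zc a) (\<epsilon> * r) \<le> \<epsilon> * (L * 3 powr (2 * m) * scale z r)"
      using mult_left_mono[of "scale (zc a) (\<epsilon> * r)" "\<epsilon> * (3 powr (2 * m) * scale z r)" L] L_pos by (simp add: mult_ac)
    have "\<bar>hgrad (zc a) \<bullet> (zc b - zc a)\<bar> \<le> norm (hgrad (zc a)) * (\<epsilon> * r)"
      using near by (intro order_trans[OF Cauchy_Schwarz_ineq2] mult_left_mono) (auto simp: near_def)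
    also have "\<dots> = \<epsilon> * (norm (hgrad (zc a)) * r)" by simp
    also have "\<dots> \<le> \<epsilon> * (norm (hgrad z) * r + 2 * L * 2 powr (2 * m) * scale z r)"
      using 2 \<epsilon> by (intro mult_left_mono) auto
    finally have 4: "\<bar>hgrad (zc a) \<bullet> (zc b - zc a)\<bar> \<le> \<epsilon> * (norm (hgrad z) * r + 2 * L * 2 powr (2 * m) * scale z r)" .
    have "ht b \<ge> ht a - \<epsilon> * (norm (hgrad z) * r + 2 * L * 2 powr (2 * m) * scale z r) - \<epsilon> * (L * 3 powr (2 * m) * scale z r)"
      using near 3 4 unfolding near_def by linarith
    moreover have "\<epsilon> * (norm (hgrad z) * r + 2 * L * 2 powr (2 * m) * scale z r) + \<epsilon> * (L * 3 powr (2 * m) * scale z r) \<le> \<epsilon> * (E * gain z r)"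
    proof -
      have "norm (hgrad z) * r + 2 * L * 2 powr (2 * m) * scale z r + L * 3 powr (2 * m) * scale z r
          \<le> E * (norm (hgrad z) * r) + E * scale z r"
      proof -
        have "norm (hgrad z) * r \<le> E * (norm (hgrad z) * r)"
          using mult_right_mono[of 1 E "norm (hgrad z) * r"] \<open>r > 0\<close> L_pos by (simp add: E_def)
        moreover have "(2 * L * 2 powr (2 * m) + L * 3 powr (2 * m)) * scale z r \<le> E * scale z r"
          using scale_nonneg by (intro mult_right_mono) (auto simp: E_def)
        ultimately show ?thesis by (simp add: distrib_right)
      qed
      then have "\<epsilon> * (norm (hgrad z) * r + 2 * L * 2 powr (2 * m) * scale z r + L * 3 powr (2 * m) * scale z r) \<le> \<epsilon> * (E * gain z r)"
        unfolding gain_def using \<epsilon> by (intro mult_left_mono) (auto simp: distrib_left)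
      then show ?thesis by (simp add: distrib_left)
    qed
    moreover have "\<epsilon> * (E * gain z r) \<le> c / 2 * gain z r"
      using mult_right_mono[OF \<epsilon>E gain_nonneg[OF \<open>0 \<le> r\<close>]] by (simp add: mult.assoc)
    moreover have "c / 2 * gain z r > 0"
      using assms \<open>r > 0\<close> scale_pos[of r z] by (auto simp: gain_def intro!: mult_pos_pos add_nonneg_pos)
    ultimately have "ht b > 0" using ha by linarith
    then show "b \<in> epi \<phi>" by (simp add: mem_epi_iff)
  qed
qed

text \<open>Both parts of the gain move by at most a multiple of the scale: H by \<open>L\<close>,
  the scale itself by 2^(2m). It compares the heights reached by the cones from p and from
  q.\<close>

lemma gain_base_le:
  assumes "0 \<le> r" "norm (z - w) \<le> r"
  shows "gain z r \<le> (1 + L + 2 powr (2 * m)) * gain w r"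
proof -
  have "norm (hgrad z) * r \<le> norm (hgrad w) * r + norm (hgrad z - hgrad w) * r"
    unfolding distrib_right[symmetric] using assms norm_triangle_sub by (intro mult_right_mono) auto
  moreover have "norm (hgrad z - hgrad w) * r \<le> L * scale w r"
    using assms by (rule hgrad_diff_le)
  moreover have "scale z r \<le> 2 powr (2 * m) * scale w r"
    using scale_base_le[of r 1 z w] assms by simp
  moreover have "0 \<le> (L + 2 powr (2 * m)) * (norm (hgrad w) * r)" "0 \<le> scale w r"
    using assms L_pos scale_nonneg by auto
  ultimately show ?thesis by (simp add: gain_def algebra_simps)
qed

text \<open>For r >= 1 the scale is at least r^2 >= r, so a large radius dominates any height
  difference. This makes all distances finite.\<close>

lemma near_exists: "\<exists>r\<ge>0. near p r 1 q"
proof -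
  define \<tau> where "\<tau> = \<bar>ht q - ht p - hgrad (zc p) \<bullet> (zc q - zc p)\<bar>"
  define r where "r = 1 + norm (zc q - zc p) + \<tau>"
  have r: "r \<ge> 1" "norm (zc q - zc p) \<le> r" "\<tau> \<le> r" by (auto simp: r_def \<tau>_def)
  have "r * 1 \<le> r\<^sup>2 * 1" using r by (simp add: power2_eq_square)
  also have "\<dots> \<le> r\<^sup>2 * (norm (zc p) + r) powr (2 * m)"
    using r m norm_ge_zero[of "zc p"] by (intro mult_left_mono ge_one_powr_ge_zero) (auto simp del: norm_ge_zero)
  finally have "near p r 1 q" using r by (simp add: near_def scale_def \<tau>_def)
  then show ?thesis using r by (intro exI[of _ r]) auto
qed

lemma cc_dist_finite: "cc_dist m p q < \<infinity>"
  by (metis cc_dist_near[of 1] near_exists ennreal_less_top infinity_ennreal_def order_le_less_trans zero_le_one)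

text \<open>The scale vanishes quadratically as r tends to 0. Distinct points are thus at positive
  distance, and the construction can start with r > 0.\<close>

lemma eq_if_cc_dist_0:
  assumes "cc_dist m p q = 0"
  shows "p = q"
proof -
  have near: "near p r L q" if "r > 0" for r
    using that assms by (intro near_if_cc_dist_less) simp
  have "norm (zc q - zc p) \<le> 0"
    by (rule field_le_epsilon) (use near in \<open>auto simp: near_def\<close>)
  then have z: "zc q = zc p" by simp
  define K where "K = L * (norm (zc p) + 1) powr (2 * m)"
  have "K \<ge> 0" using L_pos by (simp add: K_def)
  have le: "\<bar>ht q - ht p\<bar> \<le> K * r" if "0 < r" "r \<le> 1" for r
  proof -
    have "scale (zc p) r \<le> r\<^sup>2 * scale (zc p) 1"
      using scale_contract[of 1 r "zc p"] that by simp
    also have "\<dots> \<le> r * scale (zc p) 1"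
      using that scale_nonneg by (intro mult_right_mono) (auto simp: power2_eq_square)
    finally have "L * scale (zc p) r \<le> L * (r * scale (zc p) 1)"
      using L_pos by (intro mult_left_mono) auto
    then show ?thesis using near[OF that(1)] z by (simp add: near_def K_def scale_def mult_ac)
  qed
  have "ht q = ht p"
  proof (rule ccontr)
    assume "ht q \<noteq> ht p"
    then have pos: "\<bar>ht q - ht p\<bar> > 0" by simp
    \<comment> \<open>Chosen so that (K + 1) r is at most half the height gap, with r <= 1 to make
      \<open>le\<close> available.\<close>
    define r where "r = min 1 (\<bar>ht q - ht p\<bar> / (2 * (K + 1)))"
    have "r > 0" "r \<le> 1" using pos \<open>K \<ge> 0\<close> by (auto simp: r_def)
    then have "\<bar>ht q - ht p\<bar> \<le> (K + 1) * r" using le[of r] by (simp add: distrib_right)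
    also have "\<dots> \<le> (K + 1) * (\<bar>ht q - ht p\<bar> / (2 * (K + 1)))"
      using \<open>K \<ge> 0\<close> by (intro mult_left_mono) (auto simp: r_def)
    also have "\<dots> = \<bar>ht q - ht p\<bar> / 2" using \<open>K \<ge> 0\<close> by (simp add: field_simps)
    finally show False using pos by simp
  qed
  then show ?thesis using z lift_ht by metis
qed

section \<open>Cone curves and the connecting curve\<close>

definition cone :: "pt \<Rightarrow> real \<Rightarrow> (real \<times> real) \<times> real" where
  "cone p s = (zc p + s *\<^sub>R sgn (hgrad (zc p)), ht p + gain (zc p) s)"

text \<open>Moving along the direction of H makes the first-order term equal to |H| s, which cancels
  the linear part of the gain and leaves exactly the scale. Where H = 0, \<open>sgn\<close> is 0:
  the cone rises vertically by the scale alone.\<close>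

lemma near_lift_cone:
  assumes "0 \<le> s"
  shows "near p s 1 (lift (cone p s))"
proof -
  have "hgrad (zc p) \<bullet> sgn (hgrad (zc p)) = norm (hgrad (zc p))"
    by (cases "hgrad (zc p) = 0") (auto simp: sgn_div_norm dot_square_norm power2_eq_square)
  then show ?thesis
    using assms scale_nonneg by (auto simp: near_def cone_def gain_def norm_sgn)
qed

lemma cone_0 [simp]: "lift (cone p 0) = p"
  by (simp add: cone_def gain_def)

lemma continuous_on_cone:
  assumes "continuous_on S f" "\<And>s. s \<in> S \<Longrightarrow> 0 \<le> f s"
  shows "continuous_on S (\<lambda>s. cone p (f s))"
proof -
  define g where "g s = (norm (zc p) + f s) powr (2 * m)" for s
  have "continuous_on S g"
    unfolding g_def using assms m by (intro continuous_on_powr' continuous_on_add continuous_on_const) auto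
  then have "continuous_on S (\<lambda>s. (zc p + f s *\<^sub>R sgn (hgrad (zc p)),
      ht p + (norm (hgrad (zc p)) * f s + (f s)\<^sup>2 * g s)))"
    using assms(1) by (intro continuous_intros)
  then show ?thesis by (simp add: cone_def gain_def scale_def g_def)
qed

lemma continuous_on_lift:
  assumes "continuous_on S f"
  shows "continuous_on S (\<lambda>s. lift (f s))"
proof -
  have "continuous_on UNIV \<phi>"
    using smooth[unfolded smooth2_def, rule_format, of "[]"] by simp
  then have "continuous_on S (\<lambda>s. \<phi> (fst (f s)))"
    by (rule continuous_on_compose2) (auto intro: continuous_on_fst assms)
  then show ?thesis unfolding lift_def using assms by (intro continuous_intros)
qed

text \<open>A quasi-triangle inequality from p through q to a. Besides the two given errors there is
  only the change of H between p and q, paired with a step of size r.\<close>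

lemma near_step:
  assumes "near p r L q" "0 \<le> s" "s \<le> r" "near q s 1 a"
  shows "near p (2 * r) (2 * L + 1) a"
proof -
  have "0 \<le> r" using assms by linarith
  have d: "norm (zc q - zc p) \<le> r" "norm (zc a - zc q) \<le> r" using assms by (auto simp: near_def)
  have 1: "ht a - ht p - hgrad (zc p) \<bullet> (zc a - zc p)
     = (ht q - ht p - hgrad (zc p) \<bullet> (zc q - zc p)) + (ht a - ht q - hgrad (zc q) \<bullet> (zc a - zc q))
       + (hgrad (zc q) - hgrad (zc p)) \<bullet> (zc a - zc q)"
    by (simp add: inner_diff_left inner_diff_right)
  have "\<bar>(hgrad (zc q) - hgrad (zc p)) \<bullet> (zc a - zc q)\<bar> \<le> norm (hgrad (zc q) - hgrad (zc p)) * r"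
    using d by (intro order_trans[OF Cauchy_Schwarz_ineq2] mult_left_mono) auto
  also have "\<dots> \<le> L * scale (zc p) r" using \<open>0 \<le> r\<close> d(1) by (rule hgrad_diff_le)
  finally have "\<bar>ht a - ht p - hgrad (zc p) \<bullet> (zc a - zc p)\<bar> \<le> 2 * (L * scale (zc p) r) + scale (zc q) r"
    unfolding 1 using assms(1,4) scale_mono[OF assms(2,3), of "zc q"] unfolding near_def by linarith
  also have "\<dots> \<le> 2 * (L * scale (zc p) (2 * r)) + scale (zc p) (2 * r)"
    using L_pos \<open>0 \<le> r\<close> scale_double_le[OF \<open>0 \<le> r\<close> d(1)] scale_nonneg[of "zc q" r]
    by (intro add_mono mult_left_mono scale_mono) auto
  finally show ?thesis
    using d norm_triangle_ineq[of "zc a - zc q" "zc q - zc p"] by (simp add: near_def algebra_simps)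
qed

lemma near_lift_segment:
  assumes "near p r A (lift v)" "near p r A (lift w)" "0 \<le> u" "u \<le> 1"
  shows "near p r A (lift (v + u *\<^sub>R (w - v)))"
proof -
  have "norm (fst v - zc p + u *\<^sub>R (fst w - fst v)) = norm ((1 - u) *\<^sub>R (fst v - zc p) + u *\<^sub>R (fst w - zc p))"
    by (simp add: algebra_simps)
  also have "\<dots> \<le> (1 - u) * r + u * r"
    using assms by (intro order_trans[OF norm_triangle_ineq] add_mono) (auto simp: near_def intro: mult_left_mono)
  finally have 1: "norm (fst v - zc p + u *\<^sub>R (fst w - fst v)) \<le> r" by (simp add: algebra_simps)
  define f where "f w = snd w - ht p - hgrad (zc p) \<bullet> (fst w - zc p)" for w :: "(real \<times> real) \<times> real"
  define B where "B = A * scale (zc p) r"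
  have fB: "\<bar>f v\<bar> \<le> B" "\<bar>f w\<bar> \<le> B" using assms by (auto simp: near_def f_def B_def)
  have "f (v + u *\<^sub>R (w - v)) = (1 - u) * f v + u * f w"
    by (simp add: f_def inner_add_right inner_diff_right algebra_simps)
  also have "\<bar>\<dots>\<bar> \<le> (1 - u) * B + u * B"
    using assms fB by (intro order_trans[OF abs_triangle_ineq] add_mono) (auto simp: abs_mult intro: mult_left_mono)
  finally have "\<bar>f (v + u *\<^sub>R (w - v))\<bar> \<le> B" by (simp add: algebra_simps)
  with 1 show ?thesis by (simp add: near_def f_def B_def algebra_simps)
qed

text \<open>Each term freezes outside its own third of the interval, and the last one is 0 until s =
  2/3. Continuity then follows from that of \<open>clamp01\<close> and \<open>cone\<close>.\<close>

definition track :: "pt \<Rightarrow> pt \<Rightarrow> real \<Rightarrow> real \<Rightarrow> (real \<times> real) \<times> real" where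
  "track p q r s = cone p (r * clamp01 (3 * s)) + clamp01 (3 * s - 1) *\<^sub>R (cone q r - cone p r)
     + (cone q (r * clamp01 (3 - 3 * s)) - cone q r)"

lemma track_cases:
  shows "s \<in> {0..1/3} \<Longrightarrow> track p q r s = cone p (r * (3 * s))"
    and "s \<in> {1/3..2/3} \<Longrightarrow> track p q r s = cone p r + (3 * s - 1) *\<^sub>R (cone q r - cone p r)"
    and "s \<in> {2/3..1} \<Longrightarrow> track p q r s = cone q (r * (3 - 3 * s))"
  by (auto simp: track_def clamp01_simps)

lemma clamp01_nonneg: "0 \<le> clamp01 x" by (simp add: clamp01_def)

lemma continuous_on_track:
  assumes "0 \<le> r"
  shows "continuous_on S (\<lambda>s. lift (track p q r s))"
  unfolding track_def using assms clamp01_nonneg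
  by (intro continuous_on_lift continuous_intros continuous_on_cone) auto

lemma near_track:
  assumes "near p r L q" "0 \<le> r" "s \<in> {0..1}"
  shows "near p (2 * r) (2 * L + 1) (lift (track p q r s))"
proof -
  have cone_p: "near p (2 * r) (2 * L + 1) (lift (cone p u))" if "0 \<le> u" "u \<le> r" for u
    by (rule near_mono[OF near_lift_cone[OF that(1)]]) (use that L_pos in auto)
  have cone_q: "near p (2 * r) (2 * L + 1) (lift (cone q u))" if "0 \<le> u" "u \<le> r" for u
    using assms(1) that near_lift_cone[OF that(1)] by (rule near_step)
  consider "s \<in> {0..1/3}" | "s \<in> {1/3..2/3}" | "s \<in> {2/3..1}" using assms(3) by force
  then show ?thesis
  proof cases
    case 1
    then have "r * (3 * s) \<le> r" using \<open>0 \<le> r\<close> by (intro mult_right_le_one_le) auto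
    then show ?thesis using 1 \<open>0 \<le> r\<close> by (simp add: track_cases(1) cone_p)
  next
    case 2
    then show ?thesis unfolding track_cases(2)[OF 2]
      by (intro near_lift_segment cone_p cone_q) (use \<open>0 \<le> r\<close> in auto)
  next
    case 3
    then have "r * (3 - 3 * s) \<le> r" using \<open>0 \<le> r\<close> by (intro mult_right_le_one_le) auto
    then show ?thesis using 3 \<open>0 \<le> r\<close> by (simp add: track_cases(3) cone_q)
  qed
qed

text \<open>The height is affine along the segment, so the two ends decide. At the end of the cone
  from q the gain over q is converted to that over p.\<close>

lemma ht_segment_ge:
  assumes "near p r L q" "0 \<le> r" "0 < ht p" "0 < ht q" "0 \<le> u" "u \<le> 1"
  shows "gain (zc p) r \<le> (1 + L + 2 powr (2 * m)) * ht (lift (cone p r + u *\<^sub>R (cone q r - cone p r)))"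
proof -
  define K where "K = 1 + L + 2 powr (2 * m)"
  have "K \<ge> 1" using L_pos by (simp add: K_def)
  have G: "0 \<le> gain (zc p) r" "gain (zc p) r \<le> K * gain (zc q) r"
    using gain_nonneg gain_base_le[of r "zc p" "zc q"] assms
    by (auto simp: K_def near_def norm_minus_commute)
  have "gain (zc p) r \<le> K * snd (cone p r)"
    using mult_mono[of 1 K "gain (zc p) r" "snd (cone p r)"] \<open>K \<ge> 1\<close> G assms by (simp add: cone_def)
  moreover have "K * gain (zc q) r \<le> K * snd (cone q r)"
    using \<open>K \<ge> 1\<close> assms by (intro mult_left_mono) (auto simp: cone_def)
  ultimately have "(1 - u) * gain (zc p) r + u * gain (zc p) r
      \<le> (1 - u) * (K * snd (cone p r)) + u * (K * snd (cone q r))"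
    using G assms by (intro add_mono mult_left_mono) auto
  also have "\<dots> = K * (snd (cone p r) + u * (snd (cone q r) - snd (cone p r)))"
    by (simp add: algebra_simps)
  finally show ?thesis by (simp add: K_def algebra_simps)
qed

lemma epi_uniform_domain:
  "\<exists>\<epsilon> > 0. \<exists>\<delta> > 0. \<forall>p \<in> epi \<phi>. \<forall>q \<in> epi \<phi>.
           \<exists>\<gamma> :: real \<Rightarrow> pt.
             continuous_on {0..1} \<gamma> \<and> \<gamma> ` {0..1} \<subseteq> epi \<phi> \<and> \<gamma> 0 = p \<and> \<gamma> 1 = q \<and>
             cc_diam m (\<gamma> ` {0..1}) \<le> ennreal (1 / \<delta>) * cc_dist m p q \<and>
             (\<forall>t \<in> {0..1}. cc_ball m (\<gamma> t)
                 (ennreal \<epsilon> * (min (cc_diam m (\<gamma> ` {0..t})) (cc_diam m (\<gamma> ` {t..1}))))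
               \<subseteq> epi \<phi>)"
proof -
  define K where "K = 1 + L + 2 powr (2 * m)"
  have "K \<ge> 1" using L_pos by (simp add: K_def)
  have "0 \<le> 2 * L + 1" using L_pos by simp
  then obtain U where "U > 0" and U: "\<And>p S r. 0 \<le> r \<Longrightarrow> (\<And>a. a \<in> S \<Longrightarrow> near p r (2 * L + 1) a)
      \<Longrightarrow> cc_diam m S \<le> ennreal (U * r)"
    by (rule cc_diam_near) blast
  obtain \<epsilon> where "\<epsilon> > 0" and \<epsilon>: "\<And>z a r. \<lbrakk>0 \<le> r; norm (zc a - z) \<le> 2 * r; 1 / K * gain z r \<le> ht a\<rbrakk>
       \<Longrightarrow> cc_ball m a (ennreal (\<epsilon> * r)) \<subseteq> epi \<phi>"
    using cc_ball_subset_epi[of "1 / K"] \<open>K \<ge> 1\<close> by auto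
  \<comment> \<open>Diameters are bounded by U (2r), while \<open>\<epsilon>\<close> admits balls of
    radius \<open>\<epsilon>\<close> r; the quotient accounts for both.\<close>
  define \<epsilon>' where "\<epsilon>' = \<epsilon> / (2 * U)"
  have "\<epsilon>' > 0" using \<open>\<epsilon> > 0\<close> \<open>U > 0\<close> by (simp add: \<epsilon>'_def)
  have ball: "cc_ball m a (ennreal \<epsilon>' * D) \<subseteq> epi \<phi>"
    if "0 \<le> r" "norm (zc a - z) \<le> 2 * r" "gain z r \<le> K * ht a" "D \<le> ennreal (U * (2 * r))" for z a r D
  proof -
    have "1 / K * gain z r \<le> ht a" using that(3) \<open>K \<ge> 1\<close> by (simp add: pos_divide_le_eq mult.commute)
    note \<epsilon>[OF that(1,2) this]
    moreover have "ennreal \<epsilon>' * D \<le> ennreal \<epsilon>' * ennreal (U * (2 * r))" using that(4) by (rule mult_left_mono) simp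
    moreover have "ennreal \<epsilon>' * ennreal (U * (2 * r)) = ennreal (\<epsilon> * r)"
      using \<open>\<epsilon>' > 0\<close> \<open>U > 0\<close> by (subst ennreal_mult'[symmetric]) (auto simp: \<epsilon>'_def)
    ultimately show ?thesis unfolding cc_ball_def by (auto dest: order_less_le_trans)
  qed
  have "\<exists>\<gamma> :: real \<Rightarrow> pt.
             continuous_on {0..1} \<gamma> \<and> \<gamma> ` {0..1} \<subseteq> epi \<phi> \<and> \<gamma> 0 = p \<and> \<gamma> 1 = q \<and>
             cc_diam m (\<gamma> ` {0..1}) \<le> ennreal (1 / (1 / (4 * U))) * cc_dist m p q \<and>
             (\<forall>t \<in> {0..1}. cc_ball m (\<gamma> t)
                 (ennreal \<epsilon>' * (min (cc_diam m (\<gamma> ` {0..t})) (cc_diam m (\<gamma> ` {t..1}))))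
               \<subseteq> epi \<phi>)" if pq: "p \<in> epi \<phi>" "q \<in> epi \<phi>" for p q
  proof (cases "p = q")
    case True
    \<comment> \<open>For the constant curve all diameters are 0, and the balls to be fitted are
      empty.\<close>
    have "cc_diam m ((\<lambda>_. p) ` S) = 0" if "S \<noteq> {}" for S :: "real set"
      using that m by (simp add: cc_diam_def image_constant_conv)
    then show ?thesis
      using True pq by (intro exI[of _ "\<lambda>_. p"]) (auto simp: cc_ball_def min_def)
  next
    case False
    define r where "r = 2 * enn2real (cc_dist m p q)"
    have d: "cc_dist m p q = ennreal (r / 2)" using cc_dist_finite[of p q] by (simp add: r_def)
    have "r > 0" using False eq_if_cc_dist_0[of p q] d by (cases "r > 0") (auto simp: ennreal_neg)
    then have "cc_dist m p q < ennreal r" unfolding d by (simp add: ennreal_lessI)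
    then have near: "near p r L q" by (rule near_if_cc_dist_less)
    have ht: "0 < ht p" "0 < ht q" using pq by (auto simp: mem_epi_iff)
    define \<gamma> where "\<gamma> s = lift (track p q r s)" for s
    have \<gamma>1: "\<gamma> s = lift (cone p (r * (3 * s)))" if "s \<in> {0..1/3}" for s
      using track_cases(1)[OF that] by (simp add: \<gamma>_def)
    have \<gamma>2: "\<gamma> s = lift (cone p r + (3 * s - 1) *\<^sub>R (cone q r - cone p r))" if "s \<in> {1/3..2/3}" for s
      using track_cases(2)[OF that] by (simp add: \<gamma>_def)
    have \<gamma>3: "\<gamma> s = lift (cone q (r * (3 - 3 * s)))" if "s \<in> {2/3..1}" for s
      using track_cases(3)[OF that] by (simp add: \<gamma>_def)
    have near\<gamma>: "near p (2 * r) (2 * L + 1) (\<gamma> s)" if "s \<in> {0..1}" for s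
      unfolding \<gamma>_def using near_track[OF near _ that] \<open>r > 0\<close> by simp
    have diam: "cc_diam m (\<gamma> ` S) \<le> ennreal (U * (2 * r))" if "S \<subseteq> {0..1}" for S
      by (rule U[where p = p]) (use that near\<gamma> \<open>r > 0\<close> in auto)
    \<comment> \<open>The cone condition at parameter u: the piece run so far has diameter of order
      u, while the height is at least the gain at u.\<close>
    have cone_ball: "0 < ht (lift (cone a u)) \<and>
        cc_ball m (lift (cone a u)) (ennreal \<epsilon>' * D) \<subseteq> epi \<phi>"
      if "0 < ht a" "0 \<le> u" "D \<le> ennreal (U * u)" for a u D
    proof
      have G: "0 \<le> gain (zc a) u" using that(2) by (rule gain_nonneg)
      then show pos: "0 < ht (lift (cone a u))" using that(1) by (simp add: cone_def)
      show "cc_ball m (lift (cone a u)) (ennreal \<epsilon>' * D) \<subseteq> epi \<phi>"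
      proof (rule ball[OF that(2)])
        show "norm (zc (lift (cone a u)) - zc a) \<le> 2 * u"
          using near_lift_cone[OF that(2), of a] that(2) by (simp add: near_def)
        have "gain (zc a) u \<le> 1 * ht (lift (cone a u))" using that(1) by (simp add: cone_def)
        also have "\<dots> \<le> K * ht (lift (cone a u))" using pos \<open>K \<ge> 1\<close> by (intro mult_right_mono) auto
        finally show "gain (zc a) u \<le> K * ht (lift (cone a u))" .
        have "U * u \<le> U * (2 * u)" using \<open>U > 0\<close> that(2) by (intro mult_left_mono) auto
        then show "D \<le> ennreal (U * (2 * u))" using that(3) by (meson ennreal_leI order_trans)
      qed
    qed
    have cone_near: "near a v (2 * L + 1) (lift (cone a u))" if "0 \<le> u" "u \<le> v" for a u v
      by (rule near_mono[OF near_lift_cone[OF that(1)]]) (use that L_pos in auto)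
    \<comment> \<open>On the outer thirds the minimum is bounded by the diameter of the piece
      towards the nearer end of the curve. On the middle third the height is of order gain(z_p, r),
      which suffices even against the diameter of the whole curve.\<close>
    have inside: "0 < ht (\<gamma> t) \<and> cc_ball m (\<gamma> t)
                 (ennreal \<epsilon>' * (min (cc_diam m (\<gamma> ` {0..t})) (cc_diam m (\<gamma> ` {t..1})))) \<subseteq> epi \<phi>"
      if t: "t \<in> {0..1}" for t
    proof -
      consider "t \<in> {0..1/3}" | "t \<in> {1/3..2/3}" | "t \<in> {2/3..1}" using t by force
      then show ?thesis
      proof cases
        case 1
        have "cc_diam m (\<gamma> ` {0..t}) \<le> ennreal (U * (r * (3 * t)))"
        proof (rule U)
          fix a assume "a \<in> \<gamma> ` {0..t}"
          then obtain s where s: "s \<in> {0..t}" "a = \<gamma> s" by blast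
          have "near p (r * (3 * t)) (2 * L + 1) (lift (cone p (r * (3 * s))))"
            using s \<open>r > 0\<close> by (intro cone_near) auto
          then show "near p (r * (3 * t)) (2 * L + 1) a" using s 1 by (simp add: \<gamma>1)
        qed (use 1 \<open>r > 0\<close> in auto)
        then show ?thesis unfolding \<gamma>1[OF 1]
          by (intro cone_ball[OF ht(1)]) (use 1 \<open>r > 0\<close> in \<open>auto intro: min.coboundedI1\<close>)
      next
        case 3
        have "cc_diam m (\<gamma> ` {t..1}) \<le> ennreal (U * (r * (3 - 3 * t)))"
        proof (rule U)
          fix a assume "a \<in> \<gamma> ` {t..1}"
          then obtain s where s: "s \<in> {t..1}" "a = \<gamma> s" by blast
          have "near q (r * (3 - 3 * t)) (2 * L + 1) (lift (cone q (r * (3 - 3 * s))))"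
            using s \<open>r > 0\<close> by (intro cone_near) auto
          then show "near q (r * (3 - 3 * t)) (2 * L + 1) a" using s 3 by (simp add: \<gamma>3)
        qed (use 3 \<open>r > 0\<close> in auto)
        then show ?thesis unfolding \<gamma>3[OF 3]
          by (intro cone_ball[OF ht(2)]) (use 3 \<open>r > 0\<close> in \<open>auto intro: min.coboundedI2\<close>)
      next
        case 2
        have G: "gain (zc p) r \<le> K * ht (\<gamma> t)"
          unfolding \<gamma>2[OF 2] K_def by (rule ht_segment_ge[OF near _ ht]) (use 2 \<open>r > 0\<close> in auto)
        have "0 < gain (zc p) r"
          using \<open>r > 0\<close> scale_pos[of r "zc p"] by (auto simp: gain_def intro!: add_nonneg_pos)
        then have "0 < ht (\<gamma> t)" using G \<open>K \<ge> 1\<close> by (smt (verit) zero_less_mult_iff)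
        moreover have "cc_diam m (\<gamma> ` {0..t}) \<le> ennreal (U * (2 * r))" using t by (intro diam) auto
        then have "cc_ball m (\<gamma> t)
            (ennreal \<epsilon>' * (min (cc_diam m (\<gamma> ` {0..t})) (cc_diam m (\<gamma> ` {t..1})))) \<subseteq> epi \<phi>"
          using near\<gamma>[OF t] \<open>r > 0\<close> G
          by (intro ball[of r _ "zc p"]) (auto simp: near_def intro: min.coboundedI1)
        ultimately show ?thesis by blast
      qed
    qed
    show ?thesis
    proof (intro exI[of _ \<gamma>] conjI)
      show "continuous_on {0..1} \<gamma>"
        unfolding \<gamma>_def using \<open>r > 0\<close> by (intro continuous_on_track) auto
      show "\<gamma> ` {0..1} \<subseteq> epi \<phi>" using inside by (auto simp: mem_epi_iff)
      show "\<gamma> 0 = p" by (simp add: \<gamma>1)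
      show "\<gamma> 1 = q" by (simp add: \<gamma>3)
      \<comment> \<open>Since r is twice the distance, the diameter bound is 4U times the distance;
        this is why delta is 1/(4U).\<close>
      have "U * (2 * r) = (4 * U) * (r / 2)" by simp
      then have "ennreal (U * (2 * r)) = ennreal (4 * U) * ennreal (r / 2)"
        using \<open>U > 0\<close> by (metis ennreal_mult' less_eq_real_def zero_le_mult_iff zero_le_numeral)
      then show "cc_diam m (\<gamma> ` {0..1}) \<le> ennreal (1 / (1 / (4 * U))) * cc_dist m p q"
        using diam[of "{0..1}"] by (simp add: d)
      show "\<forall>t\<in>{0..1}. cc_ball m (\<gamma> t)
                 (ennreal \<epsilon>' * (min (cc_diam m (\<gamma> ` {0..t})) (cc_diam m (\<gamma> ` {t..1})))) \<subseteq> epi \<phi>"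
        using inside by blast
    qed
  qed
  moreover have "1 / (4 * U) > 0" using \<open>U > 0\<close> by simp
  ultimately show ?thesis using \<open>\<epsilon>' > 0\<close> by blast
qed

end

theorem theorem6p2:
  fixes m :: real and \<phi> :: "real \<times> real \<Rightarrow> real" and C :: real
  assumes "m \<ge> 1" and "smooth2 \<phi>" and "C > 0"
    and "\<And>z. Dk_norm 3 \<phi> z \<le> C * norm z powr (2 * m - 1)"
    and "\<And>z. Dk_norm 2 \<phi> z \<le> C * norm z powr (2 * m)"
    and "\<And>z. Dk_norm 1 \<phi> z \<le> C * norm z powr (2 * m + 1)"
  shows "\<exists>\<epsilon> > 0. \<exists>\<delta> > 0. \<forall>p \<in> epi \<phi>. \<forall>q \<in> epi \<phi>.
           \<exists>\<gamma> :: real \<Rightarrow> real \<times> real \<times> real.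
             continuous_on {0..1} \<gamma> \<and> \<gamma> ` {0..1} \<subseteq> epi \<phi> \<and> \<gamma> 0 = p \<and> \<gamma> 1 = q \<and>
             cc_diam m (\<gamma> ` {0..1}) \<le> ennreal (1 / \<delta>) * cc_dist m p q \<and>
             (\<forall>t \<in> {0..1}. cc_ball m (\<gamma> t)
                 (ennreal \<epsilon> * (min (cc_diam m (\<gamma> ` {0..t})) (cc_diam m (\<gamma> ` {t..1}))))
               \<subseteq> epi \<phi>)"
proof -
  interpret controlled_graph m C \<phi> by unfold_locales (rule assms)+
  show ?thesis by (rule epi_uniform_domain)
qed

end
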